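(* Let $d,\Delta,s$ be positive integers. There exist constants $\Lambda=\Lambda_{d,\Delta,s}\in(0,1)$ (depending only on $d,\Delta,s$) and $c_0$ (depending only on $\Delta,s$) such that the following holds. Let $X\subset\mathbb{R}^d$ be a finite set of $n$ points and $(X,\mathcal{R})$ a semi-algebraic set system generated by $\Gamma_{d,\Delta,s}$, with VC dimension $d_0$ and shallow cell complexity $\psi(\cdot,\cdot)$. Then for all $\lambda,\eta\in(0,1)$, $(X,\mathcal{R})$ has a $\lambda$-heavy $\eta$-Mnet $\mathcal{M}$ with \[|\mathcal{M}|\le(c_0e)^{d_0}\left(\frac4{1-\lambda}\right)^{1+\frac{d_0}{\log(1-\Lambda/2)^{-1}}}\cdot\frac{24d_0}{\eta^2}\,\psi\!\left(\frac{4d_0}{\eta^2},\frac{15d_0}{\eta}\right),\] where $e$ is the base of the natural logarithm; $\Lambda$ and $c_0$ do not depend on $d_0,\eta,\lambda,n$.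
   Context: $\Gamma_{d,\Delta,s}$ is the class of subsets of $\mathbb{R}^d$ definable by a Boolean formula with at most $s$ Boolean operations (union, intersection, complement) applied to sets of the form $\{x:f(x)\ge0\}$ with $f$ a $d$-variate real polynomial of degree at most $\Delta$. A set system $(X,\mathcal{R})$ with $X\subset\mathbb{R}^d$ is generated by $\Gamma_{d,\Delta,s}$ if every $R\in\mathcal{R}$ equals $S\cap X$ for some $S\in\Gamma_{d,\Delta,s}$. $(X,\mathcal{R})$ has shallow cell complexity $\psi$ if for every finite $Y\subseteq X$ and every $\ell\le|Y|$, the number of sets of size at most $\ell$ in $\{R\cap Y:R\in\mathcal{R}\}$ is at most $|Y|\,\psi(|Y|,\ell)$. A $\lambda$-heavy $\eta$-Mnet of $(X,\mathcal{R})$ is a collection $\mathcal{M}$ of subsets of $X$ such that every $R\in\mathcal{R}$ with $|R|\ge\eta|X|$ contains some $M\in\mathcal{M}$ with $|M|\ge\lambda|R|$.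
   Formalization: The formal theorem assumes that the VC dimension d_0 is at least 1 and that ψ is nondecreasing in both arguments, since otherwise the bound can be 0 while an Mnet must be nonempty; the shallow cell complexity condition is required only for nonempty Y. *)

theory Defs
  imports Complex_Main "HOL-Library.FuncSet"
begin

text \<open>
  The dimension \<open>d\<close> is quantified inside the main statement (one of the constants must not depend
  on it), so the space of real \<open>d\<close>-tuples is a carrier set of extensional functions on
  \<open>{..<d}\<close> rather than a type indexed by its dimension.
\<close>

type_synonym point = "nat \<Rightarrow> real"

definition Rspace :: "nat \<Rightarrow> point set" where
  "Rspace d = {..<d} \<rightarrow>\<^sub>E UNIV"

definition multi_indices :: "nat \<Rightarrow> nat \<Rightarrow> (nat \<Rightarrow> nat) set" where
  "multi_indices d \<Delta> = {\<alpha> \<in> {..<d} \<rightarrow>\<^sub>E UNIV. (\<Sum>i<d. \<alpha> i) \<le> \<Delta>}"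

text \<open>
  Real polynomials in \<open>d\<close> variables of total degree at most \<open>\<Delta>\<close>, as functions. The index set of
  the sum is finite, and \<open>c\<close> is the family of coefficients.
\<close>

definition polys :: "nat \<Rightarrow> nat \<Rightarrow> (point \<Rightarrow> real) set" where
  "polys d \<Delta> = {f. \<exists>c :: (nat \<Rightarrow> nat) \<Rightarrow> real.
     f = (\<lambda>x. \<Sum>\<alpha>\<in>multi_indices d \<Delta>. c \<alpha> * (\<Prod>i<d. x i ^ \<alpha> i))}"

text \<open>
  \<open>semialg_ops d \<Delta> k S\<close>: the set \<open>S\<close> is the value of a Boolean formula with exactly \<open>k\<close>
  occurrences of union, intersection and complement.
\<close>

inductive semialg_ops :: "nat \<Rightarrow> nat \<Rightarrow> nat \<Rightarrow> point set \<Rightarrow> bool" for d \<Delta> :: nat where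
  atom: "f \<in> polys d \<Delta> \<Longrightarrow> semialg_ops d \<Delta> 0 {x \<in> Rspace d. f x \<ge> 0}"
| compl: "semialg_ops d \<Delta> k S \<Longrightarrow> semialg_ops d \<Delta> (Suc k) (Rspace d - S)"
| union: "semialg_ops d \<Delta> k S \<Longrightarrow> semialg_ops d \<Delta> l T \<Longrightarrow> semialg_ops d \<Delta> (Suc (k + l)) (S \<union> T)"
| inter: "semialg_ops d \<Delta> k S \<Longrightarrow> semialg_ops d \<Delta> l T \<Longrightarrow> semialg_ops d \<Delta> (Suc (k + l)) (S \<inter> T)"

definition semialg_class :: "nat \<Rightarrow> nat \<Rightarrow> nat \<Rightarrow> point set set" where
  "semialg_class d \<Delta> s = {S. \<exists>k\<le>s. semialg_ops d \<Delta> k S}"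

definition generated_by :: "'a set \<Rightarrow> 'a set set \<Rightarrow> 'a set set \<Rightarrow> bool" where
  "generated_by X \<R> \<Gamma> \<longleftrightarrow> (\<forall>R\<in>\<R>. \<exists>S\<in>\<Gamma>. R = S \<inter> X)"

definition set_trace :: "'a set set \<Rightarrow> 'a set \<Rightarrow> 'a set set" where
  "set_trace \<R> Y = {R \<inter> Y | R. R \<in> \<R>}"

definition shattered :: "'a set set \<Rightarrow> 'a set \<Rightarrow> bool" where
  "shattered \<R> Y \<longleftrightarrow> set_trace \<R> Y = Pow Y"

definition has_VC_dim :: "'a set \<Rightarrow> 'a set set \<Rightarrow> nat \<Rightarrow> bool" where
  "has_VC_dim X \<R> d0 \<longleftrightarrow>
     (\<exists>Y\<subseteq>X. finite Y \<and> shattered \<R> Y \<and> card Y = d0) \<and>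
     (\<forall>Y\<subseteq>X. finite Y \<and> shattered \<R> Y \<longrightarrow> card Y \<le> d0)"

text \<open>
  \<open>\<psi>\<close> has real arguments because it is evaluated at non-integer points. The empty \<open>Y\<close> is excluded:
  for it the right-hand side is \<open>0\<close>, while the trace of a nonempty system on it is \<open>{{}}\<close>, so that
  no nonempty system would have any shallow cell complexity.
\<close>

definition has_shallow_cell_complexity ::
    "'a set \<Rightarrow> 'a set set \<Rightarrow> (real \<Rightarrow> real \<Rightarrow> real) \<Rightarrow> bool" where
  "has_shallow_cell_complexity X \<R> \<psi> \<longleftrightarrow>
     (\<forall>Y\<subseteq>X. finite Y \<and> Y \<noteq> {} \<longrightarrow>
        (\<forall>l\<le>card Y. real (card {Z \<in> set_trace \<R> Y. card Z \<le> l})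
                      \<le> real (card Y) * \<psi> (real (card Y)) (real l)))"

text \<open>
  Constrains the values of \<open>\<psi>\<close> at non-integer arguments and beyond the size of the ground set,
  about which \<open>has_shallow_cell_complexity\<close> says nothing.
\<close>

definition nondecreasing2 :: "(real \<Rightarrow> real \<Rightarrow> real) \<Rightarrow> bool" where
  "nondecreasing2 \<psi> \<longleftrightarrow>
     (\<forall>a a' b b'. 0 \<le> a \<and> a \<le> a' \<and> 0 \<le> b \<and> b \<le> b' \<longrightarrow> \<psi> a b \<le> \<psi> a' b')"

definition heavy_Mnet :: "real \<Rightarrow> real \<Rightarrow> 'a set \<Rightarrow> 'a set set \<Rightarrow> 'a set set \<Rightarrow> bool" where
  "heavy_Mnet lam \<eta> X \<R> \<M> \<longleftrightarrow>
     (\<forall>M\<in>\<M>. M \<subseteq> X) \<and>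
     (\<forall>R\<in>\<R>. real (card R) \<ge> \<eta> * real (card X) \<longrightarrow>
        (\<exists>M\<in>\<M>. M \<subseteq> R \<and> real (card M) \<ge> lam * real (card R)))"

end

theory Submission
  imports Defs "HOL-Library.Nat_Bijection"
begin

text \<open>
  Sets are approximated from inside by polynomially many candidates. By linearization a polynomial is a
  linear form in its coefficients, and the space of coefficients is cut into polynomially many cells over
  each of which the sign of the form is undecided at only a small fraction of the points. This gives
  inner approximations of all members of the system up to \<open>\<epsilon>|P|\<close> points of \<open>P\<close>, at most
  \<open>A \<epsilon>\<^sup>-\<^sup>k\<close> of them, where \<open>A\<close> and \<open>k\<close> depend on \<open>d\<close>, \<open>\<Delta>\<close>, \<open>s\<close> only.

  Put \<open>\<mu> = 1 - \<lambda>\<close> and \<open>\<eta> = \<tau>\<^sup>k\<close>. If \<open>\<tau>\<close> is not small compared with a power of \<open>\<mu>\<close>, the approximations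
  of \<open>X\<close> with error \<open>\<mu>\<eta>\<close> are an Mnet. Otherwise the sets larger than \<open>\<tau>|X|\<close> are treated by
  approximations with error \<open>\<mu>\<tau>\<close>, at most \<open>A \<mu>\<^sup>-\<^sup>k / \<eta>\<close> in number. The other ones are clustered around a maximal
  packing at scale \<open>\<mu>\<eta>|X|/4\<close>, and the members of the packing are approximated with relative error
  \<open>\<mu>/4\<close>. The packing is separated by a random sample of \<open>3/(\<eta>\<tau>)\<close> points, which most of its members meet in
  at most \<open>12/\<eta>\<close> points, so its size is controlled by \<open>\<psi>\<close>. All constants and powers of
  \<open>1/\<mu>\<close> are absorbed by a sufficiently small \<open>\<Lambda>\<close>, and \<open>c0 = 1\<close> works.
\<close>

section \<open>Cuttings of parameter space\<close>

definition sign_const :: "'c set \<Rightarrow> ('c \<Rightarrow> real) \<Rightarrow> bool" where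
  "sign_const \<sigma> g \<longleftrightarrow> (\<forall>c\<in>\<sigma>. \<forall>c'\<in>\<sigma>. sgn (g c) = sgn (g c'))"

lemma sign_const_subset: "sign_const \<sigma> g \<Longrightarrow> \<tau> \<subseteq> \<sigma> \<Longrightarrow> sign_const \<tau> g"
  by (auto simp: sign_const_def)

text \<open>Sweep \<open>u\<close> upwards: the least value \<open>u t\<close> with more than
  \<open>K\<close> indices at or below it is chosen, and the recursion continues with the indices
  above it. Each choice pays for more than \<open>K\<close> indices. The condition on
  \<open>D\<close> is convexity, so a \<open>D\<close> missing \<open>u t\<close> lies on one side
  of it.\<close>

lemma quantile_net:
  fixes u :: "'i \<Rightarrow> real" and K :: real
  assumes "finite G" "K > 0"
  shows "\<exists>T\<subseteq>G. real (card T) * K \<le> real (card G) \<and>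
     (\<forall>D. (\<forall>x\<in>D. \<forall>y\<in>D. {x..y} \<subseteq> D) \<and> D \<inter> u ` T = {} \<longrightarrow> real (card {i\<in>G. u i \<in> D}) \<le> K)"
  using assms(1)
proof (induction "card G" arbitrary: G rule: less_induct)
  case less
  show ?case
  proof (cases "real (card G) \<le> K")
    case True
    have "real (card {i\<in>G. u i \<in> D}) \<le> K" for D
      using card_mono[of G "{i\<in>G. u i \<in> D}"] less.prems True by force
    then show ?thesis by (intro exI[of _ "{}"]) auto
  next
    case False
    then have "G \<noteq> {}" using assms(2) by auto
    define H where "H = {t\<in>G. real (card {i\<in>G. u i \<le> u t}) > K}"
    have "Max (u ` G) \<in> u ` G" using less.prems \<open>G \<noteq> {}\<close> by simp
    then obtain t0 where t0: "t0 \<in> G" "u t0 = Max (u ` G)" by auto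
    have "{i\<in>G. u i \<le> u t0} = G" using t0 less.prems by auto
    then have "t0 \<in> H" using False t0 by (auto simp: H_def)
    have "finite H" using less.prems by (auto simp: H_def)
    have "Min (u ` H) \<in> u ` H" using \<open>finite H\<close> \<open>t0 \<in> H\<close> by (intro Min_in) auto
    then obtain t where t: "t \<in> H" "u t = Min (u ` H)" by auto
    have tmin: "u t \<le> u t'" if "t' \<in> H" for t' using t \<open>finite H\<close> that by auto
    \<comment> \<open>The largest value below \<open>u t\<close> belongs to an index outside
      \<open>H\<close>, so at most \<open>K\<close> indices lie at or below it, and these are all
      that lie strictly below \<open>u t\<close>.\<close>
    have low: "real (card {i\<in>G. u i < u t}) \<le> K"
    proof (cases "{i\<in>G. u i < u t} = {}")
      case True then show ?thesis using assms(2) by (metis card.empty less_imp_le of_nat_0)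
    next
      case ne: False
      let ?L = "{i\<in>G. u i < u t}"
      have "Max (u ` ?L) \<in> u ` ?L" using less.prems ne by (intro Max_in) auto
      then obtain w where w: "w \<in> ?L" "u w = Max (u ` ?L)" by auto
      have "u i \<le> u w" if "i \<in> ?L" for i
        using w that less.prems by auto
      then have "?L = {i\<in>G. u i \<le> u w}" using w by fastforce
      moreover have "w \<notin> H" using tmin[of w] w by auto
      ultimately show ?thesis using w by (auto simp: H_def)
    qed
    define G' where "G' = {i\<in>G. u i > u t}"
    have G_split: "card G = card G' + card {i\<in>G. u i \<le> u t}"
      unfolding G'_def using less.prems
      by (subst card_Un_disjoint[symmetric]) (auto intro!: arg_cong[of _ _ card])
    have tH: "real (card {i\<in>G. u i \<le> u t}) > K" using t by (auto simp: H_def)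
    have "card G' < card G" using G_split tH assms(2) by linarith
    moreover have "finite G'" using less.prems by (auto simp: G'_def)
    ultimately obtain T where T: "T \<subseteq> G'" "real (card T) * K \<le> real (card G')"
      "\<forall>D. (\<forall>x\<in>D. \<forall>y\<in>D. {x..y} \<subseteq> D) \<and> D \<inter> u ` T = {} \<longrightarrow> real (card {i\<in>G'. u i \<in> D}) \<le> K"
      using less.hyps[of G'] by metis
    have "finite T" using T(1) \<open>finite G'\<close> finite_subset by blast
    have "t \<notin> T" using T(1) by (auto simp: G'_def)
    have "real (card (insert t T)) * K \<le> real (card G)"
      using T(2) G_split tH \<open>finite T\<close> \<open>t \<notin> T\<close> by (simp add: algebra_simps)
    moreover have "real (card {i\<in>G. u i \<in> D}) \<le> K"
      if D: "\<forall>x\<in>D. \<forall>y\<in>D. {x..y} \<subseteq> D" "D \<inter> u ` insert t T = {}" for D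
    proof (cases "\<exists>x\<in>D. x < u t")
      case True
      then obtain x where x: "x \<in> D" "x < u t" by auto
      have "y < u t" if "y \<in> D" for y
      proof (rule ccontr)
        assume "\<not> y < u t"
        then have "u t \<in> {x..y}" using x by simp
        moreover have "{x..y} \<subseteq> D" using D(1) x that by blast
        ultimately show False using D(2) by auto
      qed
      then have "{i\<in>G. u i \<in> D} \<subseteq> {i\<in>G. u i < u t}" by auto
      then have "card {i\<in>G. u i \<in> D} \<le> card {i\<in>G. u i < u t}"
        using less.prems by (intro card_mono) auto
      then show ?thesis using low by linarith
    next
      case False
      moreover have "u t \<notin> D" using D(2) by auto
      ultimately have "y > u t" if "y \<in> D" for y
        using that by (metis linorder_neqE_linordered_idom)
      then have "{i\<in>G. u i \<in> D} = {i\<in>G'. u i \<in> D}" by (auto simp: G'_def)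
      then show ?thesis using T(3)[rule_format, of D] D by auto
    qed
    moreover have "insert t T \<subseteq> G" using T(1) t by (auto simp: G'_def H_def)
    ultimately show ?thesis by (intro exI[of _ "insert t T"]) blast
  qed
qed

text \<open>Thresholds that mostly keep their mutual order over \<open>\<sigma>\<close> can be separated by few of them:
  quantiles of the order at one point of \<open>\<sigma>\<close>, taken among the indices \<open>G\<close> that have few order changes.\<close>

lemma refine_cell:
  fixes \<theta> :: "'i \<Rightarrow> 'c \<Rightarrow> real" and v :: "'c \<Rightarrow> real" and n \<gamma> :: real
  assumes "finite I" "real (card I) \<le> n" "n > 0" "\<gamma> > 0"
  assumes bad: "real (card {(i,i')\<in>I\<times>I. \<not> sign_const \<sigma> (\<lambda>c. \<theta> i c - \<theta> i' c)}) \<le> \<gamma>\<^sup>2 * n\<^sup>2"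
  shows "\<exists>\<D>. finite \<D> \<and> real (card \<D>) \<le> (1/\<gamma> + 2)\<^sup>2 \<and> \<Union>\<D> = \<sigma> \<and>
     (\<forall>\<tau>\<in>\<D>. real (card {i\<in>I. \<not> sign_const \<tau> (\<lambda>c. v c - \<theta> i c)}) \<le> 4 * \<gamma> * n)"
proof (cases "\<sigma> = {}")
  case True
  then show ?thesis by (intro exI[of _ "{}"]) auto
next
  case False
  then obtain c0 where c0: "c0 \<in> \<sigma>" by auto
  \<comment> \<open>\<open>B i\<close> holds the indices whose threshold changes order with that of
    \<open>i\<close> over \<open>\<sigma>\<close>. Only indices of \<open>G\<close>, with few such
    partners, may serve as separators.\<close>
  define B where "B i = {i'\<in>I. \<not> sign_const \<sigma> (\<lambda>c. \<theta> i c - \<theta> i' c)}" for i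
  define G where "G = {i\<in>I. real (card (B i)) \<le> \<gamma> * n}"
  have finB: "finite (B i)" for i using assms(1) by (auto simp: B_def)
  have finG: "finite G" using assms(1) by (auto simp: G_def)
  \<comment> \<open>Markov's inequality: each index outside \<open>G\<close> accounts for more than
    \<open>\<gamma> * n\<close> bad pairs.\<close>
  have notG: "real (card (I - G)) \<le> \<gamma> * n"
  proof -
    have "real (card (I - G)) * (\<gamma> * n) \<le> (\<Sum>i\<in>I - G. real (card (B i)))"
      using sum_bounded_below[of "I - G" "\<gamma> * n" "\<lambda>i. real (card (B i))"] by (force simp: G_def)
    also have "\<dots> = real (card (Sigma (I - G) B))"
      using assms(1) finB by (subst card_SigmaI) auto
    also have "\<dots> \<le> real (card {(i,i')\<in>I\<times>I. \<not> sign_const \<sigma> (\<lambda>c. \<theta> i c - \<theta> i' c)})"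
      using assms(1) by (intro of_nat_mono card_mono) (auto simp: B_def intro: finite_subset[of _ "I \<times> I"])
    also have "\<dots> \<le> (\<gamma> * n) * (\<gamma> * n)" using bad by (simp add: power2_eq_square algebra_simps)
    finally show ?thesis using assms by simp
  qed
  define u where "u i = \<theta> i c0" for i
  have gn: "\<gamma> * n > 0" using assms by simp
  obtain T where T: "T \<subseteq> G" "real (card T) * (\<gamma> * n) \<le> real (card G)"
    and net: "\<forall>D. (\<forall>x\<in>D. \<forall>y\<in>D. {x..y} \<subseteq> D) \<and> D \<inter> u ` T = {} \<longrightarrow> real (card {i\<in>G. u i \<in> D}) \<le> \<gamma> * n"
    using quantile_net[OF finG gn, of u] by (elim exE conjE) (rule that)
  have finT: "finite T" using T finG finite_subset by blast
  have cardG: "card G \<le> card I" using assms(1) by (intro card_mono) (auto simp: G_def)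
  have "real (card T) * \<gamma> * n \<le> 1 * n" using T cardG assms(2) by simp
  then have "real (card T) * \<gamma> \<le> 1" using assms(3) by (rule mult_right_le_imp_le)
  then have cardT: "real (card T) \<le> 1/\<gamma>" using assms(4) by (simp add: field_simps)
  \<comment> \<open>At most one separator bounds \<open>v\<close> on each side; the empty set stands
    for no bound.\<close>
  define TT where "TT = insert {} ((\<lambda>t. {t}) ` T)"
  define D where "D lo hi = {x. (\<forall>t\<in>lo. u t < x) \<and> (\<forall>t\<in>hi. x < u t)}" for lo hi
  define E where "E t = {c\<in>\<sigma>. v c = \<theta> t c}" for t
  define F where "F = (\<lambda>(lo, hi). {c\<in>\<sigma>. (\<forall>t\<in>lo. \<theta> t c < v c) \<and> (\<forall>t\<in>hi. v c < \<theta> t c)})"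
  \<comment> \<open>That no separator lies between the bounds is tested at \<open>c0\<close>,
    whereas \<open>F\<close> compares the thresholds at the varying point \<open>c\<close>.\<close>
  define Q where "Q = {(lo, hi) \<in> TT \<times> TT. D lo hi \<inter> u ` T = {}}"
  define \<D> where "\<D> = E ` T \<union> F ` Q"
  have finTT: "finite TT" using finT by (auto simp: TT_def)
  have finQ: "finite Q" using finTT by (auto simp: Q_def intro: finite_subset[of _ "TT \<times> TT"])
  have cardTT: "card TT \<le> card T + 1"
    unfolding TT_def using finT card_image_le[of T "\<lambda>t. {t}"] by (simp add: card_insert_if)
  have "card Q \<le> card (TT \<times> TT)" using finTT by (intro card_mono) (auto simp: Q_def)
  also have "\<dots> \<le> (card T + 1) * (card T + 1)"
    using mult_le_mono[OF cardTT cardTT] by (simp add: card_cartesian_product)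
  finally have cQ: "card Q \<le> (card T + 1) * (card T + 1)" .
  have "card \<D> \<le> card (E ` T) + card (F ` Q)" unfolding \<D>_def by (rule card_Un_le)
  also have "\<dots> \<le> card T + card Q" using finT finQ by (intro add_mono card_image_le)
  also have "\<dots> \<le> (card T + 2)\<^sup>2" using cQ by (simp add: power2_eq_square algebra_simps)
  finally have "real (card \<D>) \<le> (real (card T) + 2)\<^sup>2"
    by (metis of_nat_add of_nat_le_iff of_nat_numeral of_nat_power)
  also have "\<dots> \<le> (1/\<gamma> + 2)\<^sup>2" using cardT by (intro power_mono) auto
  finally have "real (card \<D>) \<le> (1/\<gamma> + 2)\<^sup>2" .
  moreover have "finite \<D>" using finT finQ by (auto simp: \<D>_def)
  moreover have "\<Union>\<D> = \<sigma>"
  proof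
    show "\<Union>\<D> \<subseteq> \<sigma>" by (auto simp: \<D>_def E_def F_def)
    show "\<sigma> \<subseteq> \<Union>\<D>"
    proof
      fix c assume c: "c \<in> \<sigma>"
      show "c \<in> \<Union>\<D>"
      proof (cases "\<exists>t\<in>T. v c = \<theta> t c")
        case True then show ?thesis using c by (auto simp: \<D>_def E_def)
      next
        case False
        \<comment> \<open>The nearest bounds at \<open>c\<close> may have separators between them at
          \<open>c0\<close>. Minimising the number of these avoids this: a remaining one could
          replace a bound, with \<open>c\<close> still in the cell.\<close>
        define ok where "ok p \<longleftrightarrow> fst p \<in> TT \<and> snd p \<in> TT \<and> c \<in> F p" for p
        define \<mu> where "\<mu> p = card {t\<in>T. u t \<in> D (fst p) (snd p)}" for p
        have "ok ({}, {})" using c by (auto simp: ok_def TT_def F_def)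
        then obtain p where p: "ok p" "\<And>p'. ok p' \<Longrightarrow> \<mu> p \<le> \<mu> p'"
          using ex_has_least_nat[of ok "({},{})" \<mu>] by blast
        obtain lo hi where lh: "p = (lo, hi)" by (cases p)
        have "D lo hi \<inter> u ` T = {}"
        proof (rule ccontr)
          assume "D lo hi \<inter> u ` T \<noteq> {}"
          then obtain t where t: "t \<in> T" "u t \<in> D lo hi" by auto
          have fin: "finite {t\<in>T. u t \<in> D lo hi}" using finT by auto
          show False
          proof (cases "\<theta> t c < v c")
            case True
            have "ok ({t}, hi)" using p(1) True t by (auto simp: ok_def lh TT_def F_def)
            moreover have "D {t} hi \<subseteq> D lo hi" "u t \<notin> D {t} hi"
              using t(2) by (auto simp: D_def dest: less_trans)
            then have "{s\<in>T. u s \<in> D {t} hi} \<subset> {s\<in>T. u s \<in> D lo hi}"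
              using t by blast
            then have "\<mu> ({t}, hi) < \<mu> p" unfolding \<mu>_def lh using fin by (simp add: psubset_card_mono)
            ultimately show False using p(2) by fastforce
          next
            case f: False
            then have "v c < \<theta> t c" using False t by force
            then have "ok (lo, {t})" using p(1) t by (auto simp: ok_def lh TT_def F_def)
            moreover have "D lo {t} \<subseteq> D lo hi" "u t \<notin> D lo {t}"
              using t(2) by (auto simp: D_def dest: less_trans)
            then have "{s\<in>T. u s \<in> D lo {t}} \<subset> {s\<in>T. u s \<in> D lo hi}"
              using t by blast
            then have "\<mu> (lo, {t}) < \<mu> p" unfolding \<mu>_def lh using fin by (simp add: psubset_card_mono)
            ultimately show False using p(2) by fastforce
          qed
        qed
        then have "p \<in> Q" using p(1) by (auto simp: Q_def ok_def lh)
        then show ?thesis using p(1) by (auto simp: \<D>_def ok_def)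
      qed
    qed
  qed
  moreover have "real (card {i\<in>I. \<not> sign_const \<tau> (\<lambda>c. v c - \<theta> i c)}) \<le> 4 * \<gamma> * n" if \<tau>: "\<tau> \<in> \<D>" for \<tau>
  proof -
    have Bt: "real (card (B t)) \<le> \<gamma> * n" if "t \<in> T" for t using that T by (auto simp: G_def)
    consider t where "t \<in> T" "\<tau> = E t" | lo hi where "(lo, hi) \<in> Q" "\<tau> = F (lo, hi)"
      using \<tau> by (auto simp: \<D>_def)
    then show ?thesis
    proof cases
      case 1
      \<comment> \<open>On \<open>E t\<close> the value \<open>v\<close> equals the threshold of
        \<open>t\<close>, so an undecided index changes order with \<open>t\<close>.\<close>
      have "{i\<in>I. \<not> sign_const \<tau> (\<lambda>c. v c - \<theta> i c)} \<subseteq> B t"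
        using 1 by (auto simp: B_def E_def sign_const_def)
      then have "card {i\<in>I. \<not> sign_const \<tau> (\<lambda>c. v c - \<theta> i c)} \<le> card (B t)"
        using finB by (rule card_mono[rotated])
      then show ?thesis using Bt[OF 1(1)] gn by linarith
    next
      case 2
      have B_TT: "real (card (\<Union>(B ` L))) \<le> \<gamma> * n" if "L \<in> TT" for L
        using that Bt gn by (auto simp: TT_def)
      let ?D = "D lo hi"
      have in_F: "c \<in> \<sigma> \<and> (\<forall>t\<in>lo. \<theta> t c < v c) \<and> (\<forall>t\<in>hi. v c < \<theta> t c)" if "c \<in> \<tau>" for c
        using that unfolding 2(2) F_def by simp
      \<comment> \<open>Such a threshold lies at or beyond a bound at \<open>c0\<close> and keeps
        this order over all of \<open>\<sigma>\<close>; as \<open>v\<close> stays strictly inside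
        the bound, it never meets the threshold.\<close>
      have "sign_const \<tau> (\<lambda>c. v c - \<theta> i c)"
        if i: "i \<in> G" "u i \<notin> ?D" "\<And>t. t \<in> lo \<Longrightarrow> i \<notin> B t" "\<And>t. t \<in> hi \<Longrightarrow> i \<notin> B t" for i
      proof -
        have iI: "i \<in> I" using i by (auto simp: G_def)
        consider t where "t \<in> lo" "u i \<le> u t" | t where "t \<in> hi" "u t \<le> u i"
          using i(2) by (auto simp: D_def not_less)
        then show ?thesis
        proof cases
          case a: 1
          have sc: "sign_const \<sigma> (\<lambda>c. \<theta> t c - \<theta> i c)" using i(3)[OF a(1)] iI by (auto simp: B_def)
          have "v c - \<theta> i c > 0" if "c \<in> \<tau>" for c
          proof -
            have c: "c \<in> \<sigma>" "\<theta> t c < v c" using in_F[OF that] a(1) by auto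
            then have "sgn (\<theta> t c - \<theta> i c) = sgn (\<theta> t c0 - \<theta> i c0)" using sc c0 unfolding sign_const_def by blast
            then have "\<theta> i c \<le> \<theta> t c" using a(2) zero_le_sgn_iff[of "\<theta> t c - \<theta> i c"] zero_le_sgn_iff[of "\<theta> t c0 - \<theta> i c0"] by (simp add: u_def)
            then show ?thesis using c by simp
          qed
          then show ?thesis by (auto simp: sign_const_def)
        next
          case b: 2
          have sc: "sign_const \<sigma> (\<lambda>c. \<theta> t c - \<theta> i c)" using i(4)[OF b(1)] iI by (auto simp: B_def)
          have "v c - \<theta> i c < 0" if "c \<in> \<tau>" for c
          proof -
            have c: "c \<in> \<sigma>" "v c < \<theta> t c" using in_F[OF that] b(1) by auto
            then have "sgn (\<theta> t c - \<theta> i c) = sgn (\<theta> t c0 - \<theta> i c0)" using sc c0 unfolding sign_const_def by blast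
            then have "\<theta> t c \<le> \<theta> i c" using b(2) sgn_le_0_iff[of "\<theta> t c - \<theta> i c"] sgn_le_0_iff[of "\<theta> t c0 - \<theta> i c0"] by (simp add: u_def)
            then show ?thesis using c by simp
          qed
          then show ?thesis by (auto simp: sign_const_def)
        qed
      qed
      \<comment> \<open>Four exceptional sets of at most \<open>\<gamma> * n\<close> indices each:
        this is the factor 4.\<close>
      then have "{i\<in>I. \<not> sign_const \<tau> (\<lambda>c. v c - \<theta> i c)}
          \<subseteq> (I - G) \<union> {i\<in>G. u i \<in> ?D} \<union> \<Union>(B ` lo) \<union> \<Union>(B ` hi)" by blast
      moreover have "finite lo" "finite hi" using 2(1) by (auto simp: Q_def TT_def)
      ultimately have "card {i\<in>I. \<not> sign_const \<tau> (\<lambda>c. v c - \<theta> i c)}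
          \<le> card ((I - G) \<union> {i\<in>G. u i \<in> ?D} \<union> \<Union>(B ` lo) \<union> \<Union>(B ` hi))"
        using assms(1) finG finB by (intro card_mono) auto
      also have "\<dots> \<le> card (I - G) + card {i\<in>G. u i \<in> ?D} + card (\<Union>(B ` lo)) + card (\<Union>(B ` hi))"
        by (meson add_mono card_Un_le le_refl le_trans)
      finally have "real (card {i\<in>I. \<not> sign_const \<tau> (\<lambda>c. v c - \<theta> i c)})
          \<le> real (card (I - G)) + real (card {i\<in>G. u i \<in> ?D}) + real (card (\<Union>(B ` lo))) + real (card (\<Union>(B ` hi)))"
        by linarith
      moreover have "real (card {i\<in>G. u i \<in> ?D}) \<le> \<gamma> * n"
      proof (intro net[rule_format] conjI ballI)
        show "{x..y} \<subseteq> ?D" if "x \<in> ?D" "y \<in> ?D" for x y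
          using that by (force simp: D_def)
        show "?D \<inter> u ` T = {}" using 2(1) by (auto simp: Q_def)
      qed
      moreover have "lo \<in> TT" "hi \<in> TT" using 2(1) by (auto simp: Q_def)
      ultimately show ?thesis using B_TT[of lo] B_TT[of hi] notG by linarith
    qed
  qed
  ultimately show ?thesis by blast
qed

text \<open>A combinatorial form of the \<open>1/r\<close>-cuttings of computational geometry, with
  \<open>\<epsilon>\<close> for \<open>1/r\<close>. Cells may overlap and have any shape; only their
  number and their undecided indices are controlled.\<close>

definition is_cutting :: "'i set \<Rightarrow> ('i \<Rightarrow> 'c \<Rightarrow> real) \<Rightarrow> real \<Rightarrow> 'c set set \<Rightarrow> bool" where
  "is_cutting I g \<epsilon> \<C> \<longleftrightarrow> finite \<C> \<and> \<Union>\<C> = UNIV \<and>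
     (\<forall>\<sigma>\<in>\<C>. real (card {i\<in>I. \<not> sign_const \<sigma> (g i)}) \<le> \<epsilon> * real (card I))"

lemma is_cutting_UNIV: "I = {} \<or> (\<forall>i\<in>I. sign_const UNIV (g i)) \<Longrightarrow> 0 \<le> \<epsilon> \<Longrightarrow> is_cutting I g \<epsilon> {UNIV}"
  unfolding is_cutting_def
proof (intro conjI ballI)
  fix \<sigma> :: "'b set" assume *: "I = {} \<or> (\<forall>i\<in>I. sign_const UNIV (g i))" "0 \<le> \<epsilon>" "\<sigma> \<in> {UNIV}"
  then have "card {i\<in>I. \<not> sign_const \<sigma> (g i)} = 0" by (subst card_eq_0_iff) blast
  then show "real (card {i\<in>I. \<not> sign_const \<sigma> (g i)}) \<le> \<epsilon> * real (card I)"
    using *(2) by simp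
qed auto

lemma sign_const_cmult: "sign_const \<sigma> g \<Longrightarrow> sign_const \<sigma> (\<lambda>c. k * g c)"
  unfolding sign_const_def sgn_mult by metis

text \<open>Eliminating the coordinate \<open>j0\<close> turns the hyperplanes into thresholds for \<open>c j0\<close>, and the
  order of two thresholds is governed by a linear form in the other coordinates. The index type is
  \<open>nat\<close> so that the induction hypothesis also applies to pairs of indices.\<close>

lemma linear_cutting_step:
  fixes a :: "nat \<Rightarrow> 'j \<Rightarrow> real" and I :: "nat set"
  assumes J: "finite J" "j0 \<notin> J" and I: "finite I" "I \<noteq> {}" and \<epsilon>: "0 < \<epsilon>"
  defines "h \<equiv> \<lambda>i (c::'j \<Rightarrow> real). \<Sum>j\<in>J. c j * a i j"
  defines "h2 \<equiv> \<lambda>m (c::'j \<Rightarrow> real). \<Sum>j\<in>J. c j *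
     (a (fst (prod_decode m)) j * a (snd (prod_decode m)) j0 - a (snd (prod_decode m)) j * a (fst (prod_decode m)) j0)"
  assumes C1: "is_cutting I h (\<epsilon>/2) \<C>1"
  assumes C2: "is_cutting (prod_encode ` (I \<times> I)) h2 ((\<epsilon>/8)\<^sup>2) \<C>2"
  shows "\<exists>\<C>. is_cutting I (\<lambda>i c. \<Sum>j\<in>insert j0 J. c j * a i j) \<epsilon> \<C> \<and>
     real (card \<C>) \<le> real (card \<C>1) * real (card \<C>2) * (8/\<epsilon> + 2)\<^sup>2"
proof -
  define n where "n = real (card I)"
  have n: "n > 0" using I by (auto simp: n_def card_gt_0_iff)
  \<comment> \<open>Forms in which \<open>c j0\<close> does not occur are left to
    \<open>\<C>1\<close>. For the others, the sign is that of \<open>c j0 - \<theta> i c\<close> up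
    to a constant nonzero factor.\<close>
  define I1 where "I1 = {i\<in>I. a i j0 \<noteq> 0}"
  define \<theta> where "\<theta> i c = - h i c / a i j0" for i c
  have finI1: "finite I1" using I by (auto simp: I1_def)
  have cardI1: "real (card I1) \<le> n" unfolding n_def using I by (intro of_nat_mono card_mono) (auto simp: I1_def)
  have h2: "h2 (prod_encode (i, i')) c = h i c * a i' j0 - h i' c * a i j0" for i i' c
    unfolding h_def h2_def sum_distrib_right sum_subtractf[symmetric]
    by (rule sum.cong) (auto simp: algebra_simps)
  \<comment> \<open>The difference of two thresholds is a constant multiple of the form
    \<open>h2\<close>, so \<open>\<C>2\<close> controls the changes of order.\<close>
  have diff: "\<theta> i c - \<theta> i' c = (- 1 / (a i j0 * a i' j0)) * h2 (prod_encode (i, i')) c"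
    if "i \<in> I1" "i' \<in> I1" for i i' c
    using that unfolding h2 by (auto simp: \<theta>_def I1_def field_simps)
  \<comment> \<open>\<open>refine_cell\<close> is used with \<open>\<gamma> = \<epsilon>/8\<close>:
    its bad pairs are a fraction \<open>\<gamma>\<^sup>2\<close> of all pairs, which is the accuracy
    of \<open>\<C>2\<close>, and it leaves \<open>\<epsilon>/2 * n\<close> undecided indices, the
    other half of the error coming from \<open>\<C>1\<close>.\<close>
  have "\<exists>\<D>. finite \<D> \<and> real (card \<D>) \<le> (1/(\<epsilon>/8) + 2)\<^sup>2 \<and> \<Union>\<D> = fst p \<inter> snd p \<and>
     (\<forall>\<tau>\<in>\<D>. real (card {i\<in>I1. \<not> sign_const \<tau> (\<lambda>c. c j0 - \<theta> i c)}) \<le> 4 * (\<epsilon>/8) * n)"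
    if p: "p \<in> \<C>1 \<times> \<C>2" for p
  proof (rule refine_cell[OF finI1 cardI1 n])
    show "0 < \<epsilon>/8" using \<epsilon> by simp
    let ?B = "{(i, i')\<in>I1\<times>I1. \<not> sign_const (fst p \<inter> snd p) (\<lambda>c. \<theta> i c - \<theta> i' c)}"
    let ?M = "{m\<in>prod_encode ` (I \<times> I). \<not> sign_const (snd p) (h2 m)}"
    have fin: "finite ?M" using I by auto
    have "prod_encode ` ?B \<subseteq> ?M"
    proof
      fix m assume "m \<in> prod_encode ` ?B"
      then obtain i i' where m: "m = prod_encode (i, i')" "i \<in> I1" "i' \<in> I1"
        and nc: "\<not> sign_const (fst p \<inter> snd p) (\<lambda>c. \<theta> i c - \<theta> i' c)" by auto
      have "\<not> sign_const (snd p) (h2 m)"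
      proof
        assume "sign_const (snd p) (h2 m)"
        then have "sign_const (fst p \<inter> snd p) (h2 m)" by (rule sign_const_subset) auto
        from sign_const_cmult[OF this, of "- 1 / (a i j0 * a i' j0)"]
        show False using nc unfolding diff[OF m(2,3)] m(1) by simp
      qed
      then show "m \<in> ?M" using m by (auto simp: I1_def)
    qed
    then have "card ?B \<le> card ?M"
      using fin inj_prod_encode by (intro card_inj_on_le[of prod_encode]) auto
    also have "real (card ?M) \<le> (\<epsilon>/8)\<^sup>2 * real (card (prod_encode ` (I \<times> I)))"
      using C2 p by (auto simp: is_cutting_def)
    also have "card (prod_encode ` (I \<times> I)) = (card I)\<^sup>2"
      by (simp add: card_image card_cartesian_product power2_eq_square inj_prod_encode)
    finally show "real (card ?B) \<le> (\<epsilon>/8)\<^sup>2 * n\<^sup>2" by (simp add: n_def)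
  qed
  then have "\<forall>p\<in>\<C>1 \<times> \<C>2. \<exists>\<D>. finite \<D> \<and> real (card \<D>) \<le> (1/(\<epsilon>/8) + 2)\<^sup>2 \<and> \<Union>\<D> = fst p \<inter> snd p \<and>
     (\<forall>\<tau>\<in>\<D>. real (card {i\<in>I1. \<not> sign_const \<tau> (\<lambda>c. c j0 - \<theta> i c)}) \<le> 4 * (\<epsilon>/8) * n)" by blast
  from bchoice[OF this] obtain \<D> where \<D>:
    "\<forall>p\<in>\<C>1 \<times> \<C>2. finite (\<D> p) \<and> real (card (\<D> p)) \<le> (1/(\<epsilon>/8) + 2)\<^sup>2 \<and> \<Union>(\<D> p) = fst p \<inter> snd p \<and>
     (\<forall>\<tau>\<in>\<D> p. real (card {i\<in>I1. \<not> sign_const \<tau> (\<lambda>c. c j0 - \<theta> i c)}) \<le> 4 * (\<epsilon>/8) * n)" ..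
  have \<D>_fin: "finite (\<D> p)" and \<D>_card: "real (card (\<D> p)) \<le> (1/(\<epsilon>/8) + 2)\<^sup>2"
    and \<D>_cov: "\<Union>(\<D> p) = fst p \<inter> snd p"
    and \<D>_cross: "\<And>\<tau>. \<tau> \<in> \<D> p \<Longrightarrow> real (card {i\<in>I1. \<not> sign_const \<tau> (\<lambda>c. c j0 - \<theta> i c)}) \<le> 4 * (\<epsilon>/8) * n"
    if "p \<in> \<C>1 \<times> \<C>2" for p
    using bspec[OF \<D> that] by simp_all
  define \<C> where "\<C> = \<Union>(\<D> ` (\<C>1 \<times> \<C>2))"
  have fin: "finite (\<C>1 \<times> \<C>2)" using C1 C2 by (auto simp: is_cutting_def)
  have "card \<C> \<le> (\<Sum>p\<in>\<C>1 \<times> \<C>2. card (\<D> p))" unfolding \<C>_def using fin by (rule card_UN_le)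
  then have "real (card \<C>) \<le> (\<Sum>p\<in>\<C>1 \<times> \<C>2. real (card (\<D> p)))"
    by (metis of_nat_le_iff of_nat_sum)
  also have "\<dots> \<le> real (card (\<C>1 \<times> \<C>2)) * (1/(\<epsilon>/8) + 2)\<^sup>2" using \<D>_card by (intro sum_bounded_above) auto
  finally have card: "real (card \<C>) \<le> real (card \<C>1) * real (card \<C>2) * (8/\<epsilon> + 2)\<^sup>2"
    by (simp add: card_cartesian_product)
  have cov: "\<Union>\<C> = UNIV"
  proof -
    have "c \<in> \<Union>\<C>" for c
    proof -
      obtain \<sigma>1 \<sigma>2 where s: "\<sigma>1 \<in> \<C>1" "c \<in> \<sigma>1" "\<sigma>2 \<in> \<C>2" "c \<in> \<sigma>2"
        using C1 C2 unfolding is_cutting_def by blast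
      then have "c \<in> \<Union>(\<D> (\<sigma>1, \<sigma>2))" using \<D>_cov by simp
      then show ?thesis using s by (auto simp: \<C>_def)
    qed
    then show ?thesis by auto
  qed
  have cross: "real (card {i\<in>I. \<not> sign_const \<tau> (\<lambda>c. \<Sum>j\<in>insert j0 J. c j * a i j)}) \<le> \<epsilon> * n" if \<tau>: "\<tau> \<in> \<C>" for \<tau>
  proof -
    obtain p where p: "p \<in> \<C>1 \<times> \<C>2" "\<tau> \<in> \<D> p" using \<tau> unfolding \<C>_def by blast
    have sub: "\<tau> \<subseteq> fst p" using p(2) \<D>_cov[OF p(1)] by blast
    have eq: "(\<Sum>j\<in>insert j0 J. c j * a i j) = c j0 * a i j0 + h i c" for i c
      using J by (simp add: h_def)
    let ?M = "{i\<in>I. \<not> sign_const (fst p) (h i)}"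
    let ?N = "{i\<in>I1. \<not> sign_const \<tau> (\<lambda>c. c j0 - \<theta> i c)}"
    have "i \<in> ?M \<union> ?N" if i: "i \<in> I" "\<not> sign_const \<tau> (\<lambda>c. \<Sum>j\<in>insert j0 J. c j * a i j)" for i
    proof (cases "a i j0 = 0")
      case True
      then have "(\<lambda>c. \<Sum>j\<in>insert j0 J. c j * a i j) = h i" unfolding eq by simp
      then have "\<not> sign_const \<tau> (h i)" using i(2) by metis
      then show ?thesis using sign_const_subset[OF _ sub] i by blast
    next
      case False
      have "(\<lambda>c. \<Sum>j\<in>insert j0 J. c j * a i j) = (\<lambda>c. a i j0 * (c j0 - \<theta> i c))"
        unfolding eq using False by (auto simp: \<theta>_def algebra_simps)
      then have "\<not> sign_const \<tau> (\<lambda>c. c j0 - \<theta> i c)" using i(2) sign_const_cmult[of \<tau> _ "a i j0"] by force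
      then show ?thesis using i False by (auto simp: I1_def)
    qed
    then have "card {i\<in>I. \<not> sign_const \<tau> (\<lambda>c. \<Sum>j\<in>insert j0 J. c j * a i j)} \<le> card (?M \<union> ?N)"
      using I finI1 by (intro card_mono) auto
    also have "\<dots> \<le> card ?M + card ?N" by (rule card_Un_le)
    also have "real \<dots> \<le> \<epsilon>/2 * n + 4 * (\<epsilon>/8) * n"
    proof -
      have "real (card ?M) \<le> \<epsilon>/2 * n" using C1 p by (auto simp: is_cutting_def n_def)
      moreover have "real (card ?N) \<le> 4 * (\<epsilon>/8) * n" using p by (intro \<D>_cross)
      ultimately show ?thesis by simp
    qed
    finally show ?thesis by simp
  qed
  have "finite \<C>" unfolding \<C>_def using fin \<D>_fin by (rule finite_UN_I)
  then have "is_cutting I (\<lambda>i c. \<Sum>j\<in>insert j0 J. c j * a i j) \<epsilon> \<C>"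
    unfolding is_cutting_def using cov cross by (simp only: n_def) blast
  then show ?thesis using card by blast
qed

text \<open>Induction on the coordinates. \<open>A\<close> and \<open>k\<close> depend on
  \<open>J\<close> only, and this uniformity is what allows the induction hypothesis to be applied
  both to the forms and to pairs of them, with different accuracies.\<close>

theorem linear_cutting:
  fixes J :: "'j set"
  assumes "finite J"
  shows "\<exists>A k. A \<ge> 1 \<and> (\<forall>(I::nat set) (a::nat \<Rightarrow> 'j \<Rightarrow> real) \<epsilon>. finite I \<and> 0 < \<epsilon> \<and> \<epsilon> \<le> 1 \<longrightarrow>
     (\<exists>\<C>. is_cutting I (\<lambda>i c. \<Sum>j\<in>J. c j * a i j) \<epsilon> \<C> \<and> real (card \<C>) \<le> A * (1/\<epsilon>) ^ k))"
  using assms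
proof induction
  case empty
  show ?case
    by (intro exI[of _ 1] exI[of _ 0] conjI allI impI exI[of _ "{UNIV}"] is_cutting_UNIV) (auto simp: sign_const_def)
next
  case (insert j0 J)
  obtain A k where A: "(A::real) \<ge> 1" and IH: "\<forall>(I::nat set) (a::nat \<Rightarrow> 'j \<Rightarrow> real) \<epsilon>.
     finite I \<and> 0 < \<epsilon> \<and> \<epsilon> \<le> 1 \<longrightarrow>
     (\<exists>\<C>. is_cutting I (\<lambda>i c. \<Sum>j\<in>J. c j * a i j) \<epsilon> \<C> \<and> real (card \<C>) \<le> A * (1/\<epsilon>) ^ k)"
    using insert.IH by (elim exE conjE) (rule that)
  \<comment> \<open>The accuracies \<open>\<epsilon>/2\<close> and
    \<open>(\<epsilon>/8)\<^sup>2\<close> contribute \<open>2 * 64 = 128\<close> and the exponents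
    \<open>k\<close> and \<open>2 * k\<close>; \<open>8/\<epsilon> + 2 \<le> 10/\<epsilon>\<close>
    contributes 100 and the exponent 2.\<close>
  let ?A = "A * A * 128 ^ k * 100" and ?k = "3 * k + 2"
  have A': "?A \<ge> 1" using A by (intro mult_ge1_I) auto
  have "\<exists>\<C>. is_cutting I (\<lambda>i c. \<Sum>j\<in>insert j0 J. c j * a i j) \<epsilon> \<C> \<and> real (card \<C>) \<le> ?A * (1/\<epsilon>) ^ ?k"
    if I: "finite I" and \<epsilon>: "0 < \<epsilon>" "\<epsilon> \<le> 1" for I :: "nat set" and a :: "nat \<Rightarrow> 'j \<Rightarrow> real" and \<epsilon>
  proof (cases "I = {}")
    case True
    have "1 * 1 \<le> ?A * (1/\<epsilon>) ^ ?k" using A' \<epsilon> by (intro mult_mono one_le_power) auto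
    then show ?thesis using True \<epsilon> by (intro exI[of _ "{UNIV}"]) (auto intro!: is_cutting_UNIV)
  next
    case False
    obtain \<C>1 where C1: "is_cutting I (\<lambda>i c. \<Sum>j\<in>J. c j * a i j) (\<epsilon>/2) \<C>1" "real (card \<C>1) \<le> A * (1/(\<epsilon>/2)) ^ k"
      using IH[rule_format, of I "\<epsilon>/2" a] I \<epsilon> by auto
    have e8: "0 < (\<epsilon>/8)\<^sup>2" "(\<epsilon>/8)\<^sup>2 \<le> 1" using \<epsilon> by (auto intro!: power_le_one)
    have fin2: "finite (prod_encode ` (I \<times> I))" using I by auto
    obtain \<C>2 where C2: "is_cutting (prod_encode ` (I \<times> I)) (\<lambda>m c. \<Sum>j\<in>J. c j *
     (a (fst (prod_decode m)) j * a (snd (prod_decode m)) j0 - a (snd (prod_decode m)) j * a (fst (prod_decode m)) j0)) ((\<epsilon>/8)\<^sup>2) \<C>2"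
      "real (card \<C>2) \<le> A * (1/(\<epsilon>/8)\<^sup>2) ^ k"
      using IH[rule_format, OF conjI[OF fin2 conjI[OF e8]], of "\<lambda>m j. a (fst (prod_decode m)) j * a (snd (prod_decode m)) j0 - a (snd (prod_decode m)) j * a (fst (prod_decode m)) j0"]
      by auto
    obtain \<C> where C: "is_cutting I (\<lambda>i c. \<Sum>j\<in>insert j0 J. c j * a i j) \<epsilon> \<C>"
     "real (card \<C>) \<le> real (card \<C>1) * real (card \<C>2) * (8/\<epsilon> + 2)\<^sup>2"
      using linear_cutting_step[OF insert.hyps I False \<epsilon>(1) C1(1) C2(1)] by auto
    define x where "x = 1/\<epsilon>"
    have *: "(A * P) * (A * Q) * (10*x)\<^sup>2 = A * A * (P * Q) * 100 * x\<^sup>2" for P Q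
      by (simp add: power2_eq_square)
    have x: "x \<ge> 1" using \<epsilon> by (simp add: x_def)
    have "(8/\<epsilon> + 2)\<^sup>2 \<le> (10*x)\<^sup>2" using \<epsilon> x by (intro power_mono) (auto simp: x_def field_simps)
    moreover have "real (card \<C>1) \<le> A * (2*x) ^ k" using C1(2) by (simp add: x_def)
    moreover have "1/(\<epsilon>/8)\<^sup>2 = 64*x^2" by (simp add: x_def power_divide)
    then have "real (card \<C>2) \<le> A * (64*x^2) ^ k" using C2(2) by simp
    ultimately have "real (card \<C>1) * real (card \<C>2) * (8/\<epsilon> + 2)\<^sup>2
        \<le> (A * (2*x) ^ k) * (A * (64*x^2) ^ k) * (10*x)\<^sup>2"
      using A x by (intro mult_mono) auto
    also have "\<dots> = A * A * ((2*x) * (64*x^2)) ^ k * 100 * x^2"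
      by (subst *) (simp only: power_mult_distrib)
    also have "(2*x) * (64*x^2) = 128 * x^3" by (simp add: power2_eq_square power3_eq_cube)
    also have "A * A * (128 * x^3) ^ k * 100 * x^2 = ?A * x ^ ?k"
      by (simp add: power_mult_distrib power_add power_mult power2_eq_square)
    finally have "real (card \<C>) \<le> ?A * (1/\<epsilon>) ^ ?k" using C(2) unfolding x_def by linarith
    then show ?thesis using C(1) by blast
  qed
  then show ?case using A' by blast
qed

section \<open>Bracketing of semi-algebraic sets\<close>

text \<open>Brackets as in bracketing entropy. Both ends are kept because complementation exchanges
  them.\<close>

definition is_bracketing :: "'a set \<Rightarrow> real \<Rightarrow> 'a set set \<Rightarrow> ('a set \<times> 'a set) set \<Rightarrow> bool" where
  "is_bracketing P \<epsilon> \<Gamma> \<B> \<longleftrightarrow> finite \<B> \<and>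
     (\<forall>S\<in>\<Gamma>. \<exists>(L, U)\<in>\<B>. L \<subseteq> S \<inter> P \<and> S \<inter> P \<subseteq> U \<and> U \<subseteq> P \<and> real (card (U - L)) \<le> \<epsilon> * real (card P))"

lemma finite_multi_indices: "finite (multi_indices d \<Delta>)"
proof (rule finite_subset)
  show "multi_indices d \<Delta> \<subseteq> {..<d} \<rightarrow>\<^sub>E {..\<Delta>}"
  proof
    fix \<alpha> assume \<alpha>: "\<alpha> \<in> multi_indices d \<Delta>"
    have "\<alpha> i \<le> \<Delta>" if "i < d" for i
      using \<alpha> member_le_sum[of i "{..<d}" \<alpha>] that by (auto simp: multi_indices_def)
    then show "\<alpha> \<in> {..<d} \<rightarrow>\<^sub>E {..\<Delta>}" using \<alpha> by (auto simp: multi_indices_def PiE_iff)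
  qed
qed (intro finite_PiE; simp)

text \<open>Over a cell of a cutting, the points at which the sign of a polynomial is undecided are few.\<close>

lemma polynomial_bracketing:
  "\<exists>A k. A \<ge> 1 \<and> (\<forall>P \<epsilon>. finite P \<and> P \<subseteq> Rspace d \<and> 0 < \<epsilon> \<and> \<epsilon> \<le> 1 \<longrightarrow>
     (\<exists>\<B>. is_bracketing P \<epsilon> {S. semialg_ops d \<Delta> 0 S} \<B> \<and> real (card \<B>) \<le> A * (1/\<epsilon>) ^ k))"
proof -
  let ?J = "multi_indices d \<Delta>"
  obtain A k where A: "(A::real) \<ge> 1" and cut: "\<forall>(I::nat set) (a::nat \<Rightarrow> (nat \<Rightarrow> nat) \<Rightarrow> real) \<epsilon>.
     finite I \<and> 0 < \<epsilon> \<and> \<epsilon> \<le> 1 \<longrightarrow>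
     (\<exists>\<C>. is_cutting I (\<lambda>i c. \<Sum>j\<in>?J. c j * a i j) \<epsilon> \<C> \<and> real (card \<C>) \<le> A * (1/\<epsilon>) ^ k)"
    using linear_cutting[OF finite_multi_indices[of d \<Delta>]] by (elim exE conjE) (rule that)
  have "\<exists>\<B>. is_bracketing P \<epsilon> {S. semialg_ops d \<Delta> 0 S} \<B> \<and> real (card \<B>) \<le> A * (1/\<epsilon>) ^ k"
    if P: "finite P" "P \<subseteq> Rspace d" and \<epsilon>: "0 < \<epsilon>" "\<epsilon> \<le> 1" for P \<epsilon>
  proof -
    obtain e where e: "bij_betw e {0..<card P} P" using ex_bij_betw_nat_finite[OF P(1)] by blast
    \<comment> \<open>The value at a fixed point is linear in the coefficients, with the values of
      the monomials as the data of the linear form.\<close>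
    define F where "F c x = (\<Sum>\<alpha>\<in>?J. c \<alpha> * (\<Prod>i<d. x i ^ \<alpha> i))" for c :: "(nat \<Rightarrow> nat) \<Rightarrow> real" and x :: point
    obtain \<C> where C: "is_cutting {0..<card P} (\<lambda>i c. F c (e i)) \<epsilon> \<C>" "real (card \<C>) \<le> A * (1/\<epsilon>) ^ k"
      using cut[rule_format, of "{0..<card P}" \<epsilon> "\<lambda>i \<alpha>. \<Prod>j<d. e i j ^ \<alpha> j"] \<epsilon> unfolding F_def by blast
    \<comment> \<open>A cell of coefficient vectors yields the points where all its polynomials,
      respectively some of them, are nonnegative.\<close>
    define L where "L \<sigma> = {p\<in>P. \<forall>c\<in>\<sigma>. F c p \<ge> 0}" for \<sigma>
    define U where "U \<sigma> = {p\<in>P. \<exists>c\<in>\<sigma>. F c p \<ge> 0}" for \<sigma>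
    define \<B> where "\<B> = (\<lambda>\<sigma>. (L \<sigma>, U \<sigma>)) ` \<C>"
    have fin: "finite \<C>" using C by (auto simp: is_cutting_def)
    have gap: "real (card (U \<sigma> - L \<sigma>)) \<le> \<epsilon> * real (card P)" if \<sigma>: "\<sigma> \<in> \<C>" for \<sigma>
    proof -
      let ?M = "{i\<in>{0..<card P}. \<not> sign_const \<sigma> (\<lambda>c. F c (e i))}"
      have "U \<sigma> - L \<sigma> \<subseteq> e ` ?M"
      proof
        fix p assume p: "p \<in> U \<sigma> - L \<sigma>"
        then obtain c c' where c: "c \<in> \<sigma>" "F c p \<ge> 0" "c' \<in> \<sigma>" "F c' p < 0" "p \<in> P"
          by (auto simp: U_def L_def not_le)
        obtain i where i: "i \<in> {0..<card P}" "p = e i" using e c(5) unfolding bij_betw_def by blast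
        have "sgn (F c p) \<noteq> sgn (F c' p)" using c by (simp add: sgn_if)
        then have "\<not> sign_const \<sigma> (\<lambda>c. F c (e i))" using c i unfolding sign_const_def by blast
        then show "p \<in> e ` ?M" using i by blast
      qed
      then have "card (U \<sigma> - L \<sigma>) \<le> card ?M" by (rule surj_card_le[rotated]) simp
      moreover have "real (card ?M) \<le> \<epsilon> * real (card P)" using C(1) \<sigma> by (simp add: is_cutting_def)
      ultimately show ?thesis by linarith
    qed
    have "\<exists>(L, U)\<in>\<B>. L \<subseteq> S \<inter> P \<and> S \<inter> P \<subseteq> U \<and> U \<subseteq> P \<and> real (card (U - L)) \<le> \<epsilon> * real (card P)"
      if S: "semialg_ops d \<Delta> 0 S" for S
    proof -
      obtain c where c: "S = {x \<in> Rspace d. F c x \<ge> 0}"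
        using S by cases (auto simp: polys_def F_def)
      have "c \<in> \<Union>\<C>" using C(1) by (simp add: is_cutting_def)
      then obtain \<sigma> where \<sigma>: "\<sigma> \<in> \<C>" "c \<in> \<sigma>" by blast
      have "L \<sigma> \<subseteq> S \<inter> P" "S \<inter> P \<subseteq> U \<sigma>" "U \<sigma> \<subseteq> P"
        using \<sigma>(2) P(2) by (auto simp: c L_def U_def)
      then show ?thesis using gap[OF \<sigma>(1)] \<sigma>(1) unfolding \<B>_def by blast
    qed
    then have "is_bracketing P \<epsilon> {S. semialg_ops d \<Delta> 0 S} \<B>"
      using fin unfolding is_bracketing_def \<B>_def by blast
    moreover have "card \<B> \<le> card \<C>" unfolding \<B>_def using fin by (rule card_image_le)
    ultimately show ?thesis using C(2) by (intro exI[of _ \<B>]) simp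
  qed
  then show ?thesis using A by blast
qed

text \<open>Brackets are combined as the sets are. Old brackets, complements, unions and
  intersections give the four terms of the count.\<close>

lemma bracketing_step:
  assumes P: "finite P" "P \<subseteq> Rspace d"
    and B: "is_bracketing P \<epsilon> {S. \<exists>j\<le>k. semialg_ops d \<Delta> j S} \<B>"
  shows "\<exists>\<B>'. is_bracketing P (2 * \<epsilon>) {S. \<exists>j\<le>Suc k. semialg_ops d \<Delta> j S} \<B>' \<and>
    card \<B>' \<le> 2 * card \<B> + 2 * (card \<B>)\<^sup>2"
proof -
  define ng where "ng = (\<lambda>(L, U). (P - U, P - L))"
  define un :: "(point set \<times> point set) \<times> point set \<times> point set \<Rightarrow> point set \<times> point set"
    where "un = (\<lambda>((L, U), (L', U')). (L \<union> L', U \<union> U'))"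
  define isec :: "(point set \<times> point set) \<times> point set \<times> point set \<Rightarrow> point set \<times> point set"
    where "isec = (\<lambda>((L, U), (L', U')). (L \<inter> L', U \<inter> U'))"
  define \<B>' where "\<B>' = \<B> \<union> ng ` \<B> \<union> un ` (\<B> \<times> \<B>) \<union> isec ` (\<B> \<times> \<B>)"
  have fin: "finite \<B>" using B by (simp add: is_bracketing_def)
  define br where "br S L U \<epsilon> \<longleftrightarrow> L \<subseteq> S \<inter> P \<and> S \<inter> P \<subseteq> U \<and> U \<subseteq> P \<and> real (card (U - L)) \<le> \<epsilon> * real (card P)"
    for S L U \<epsilon>
  have old: "\<exists>L U. (L, U) \<in> \<B> \<and> br S L U \<epsilon>" if "semialg_ops d \<Delta> j S" "j \<le> k" for S j
    using B that unfolding is_bracketing_def br_def by blast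
  \<comment> \<open>A point undecided for a compound set is undecided for one of its arguments. With
    a single argument the same bracket is taken twice, so all cases share this bound.\<close>
  have card_gap: "real (card W) \<le> (2 * \<epsilon>) * real (card P)"
    if "br S L U \<epsilon>" "br S' L' U' \<epsilon>" "W \<subseteq> (U - L) \<union> (U' - L')" for S L U S' L' U' W
  proof -
    have "finite ((U - L) \<union> (U' - L'))" using that P by (auto simp: br_def intro: finite_subset)
    then have "card W \<le> card ((U - L) \<union> (U' - L'))" using that by (intro card_mono)
    also have "\<dots> \<le> card (U - L) + card (U' - L')" by (rule card_Un_le)
    finally show ?thesis using that by (auto simp: br_def)
  qed
  have new: "\<exists>L U. (L, U) \<in> \<B>' \<and> br S L U (2 * \<epsilon>)" if ops: "semialg_ops d \<Delta> j S" and j: "j \<le> Suc k" for S j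
    using ops
  proof cases
    case (atom f)
    then have "semialg_ops d \<Delta> 0 S" using ops by simp
    then obtain L U where L: "(L, U) \<in> \<B>" "br S L U \<epsilon>" using old[of 0 S] by blast
    then have "br S L U (2 * \<epsilon>)" using card_gap[OF L(2) L(2), of "U - L"] by (simp add: br_def)
    then show ?thesis using L unfolding \<B>'_def by blast
  next
    case (compl k' T)
    then obtain L U where L: "(L, U) \<in> \<B>" "br T L U \<epsilon>" using old[of k' T] j by auto
    then have "(P - L) - (P - U) \<subseteq> U - L" by blast
    then have "br S (P - U) (P - L) (2 * \<epsilon>)"
      using card_gap[OF L(2) L(2), of "(P - L) - (P - U)"] L(2) compl P(2) unfolding br_def by blast
    moreover have "(P - U, P - L) \<in> \<B>'" using L(1) by (force simp: \<B>'_def ng_def)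
    ultimately show ?thesis by blast
  next
    case (union k1 T l1 T')
    \<comment> \<open>The operation at the root is counted too, so each argument has at most
      \<open>k\<close> operations.\<close>
    then obtain L U L' U' where L: "(L, U) \<in> \<B>" "br T L U \<epsilon>" "(L', U') \<in> \<B>" "br T' L' U' \<epsilon>"
      using old[of k1 T] old[of l1 T'] j by auto
    have "br S (L \<union> L') (U \<union> U') (2 * \<epsilon>)"
      using card_gap[OF L(2,4), of "(U \<union> U') - (L \<union> L')"] L(2,4) union unfolding br_def by blast
    moreover have "(L \<union> L', U \<union> U') \<in> \<B>'" using L(1,3) by (force simp: \<B>'_def un_def)
    ultimately show ?thesis by blast
  next
    case (inter k1 T l1 T')
    then obtain L U L' U' where L: "(L, U) \<in> \<B>" "br T L U \<epsilon>" "(L', U') \<in> \<B>" "br T' L' U' \<epsilon>"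
      using old[of k1 T] old[of l1 T'] j by auto
    have "br S (L \<inter> L') (U \<inter> U') (2 * \<epsilon>)"
      using card_gap[OF L(2,4), of "(U \<inter> U') - (L \<inter> L')"] L(2,4) inter unfolding br_def by blast
    moreover have "(L \<inter> L', U \<inter> U') \<in> \<B>'" using L(1,3) by (force simp: \<B>'_def isec_def)
    ultimately show ?thesis by blast
  qed
  have "is_bracketing P (2 * \<epsilon>) {S. \<exists>j\<le>Suc k. semialg_ops d \<Delta> j S} \<B>'"
    unfolding is_bracketing_def
  proof (intro conjI ballI)
    show "finite \<B>'" using fin by (simp add: \<B>'_def)
    fix S assume "S \<in> {S. \<exists>j\<le>Suc k. semialg_ops d \<Delta> j S}"
    then obtain j where "semialg_ops d \<Delta> j S" "j \<le> Suc k" by blast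
    from new[OF this] obtain L U where "(L, U) \<in> \<B>'" "br S L U (2 * \<epsilon>)" by blast
    then show "\<exists>(L, U)\<in>\<B>'. L \<subseteq> S \<inter> P \<and> S \<inter> P \<subseteq> U \<and> U \<subseteq> P \<and>
        real (card (U - L)) \<le> 2 * \<epsilon> * real (card P)"
      by (intro bexI[of _ "(L, U)"]) (simp_all add: br_def)
  qed
  moreover have "card \<B>' \<le> 2 * card \<B> + 2 * (card \<B>)\<^sup>2"
  proof -
    have "card \<B>' \<le> card \<B> + card (ng ` \<B>) + card (un ` (\<B> \<times> \<B>)) + card (isec ` (\<B> \<times> \<B>))"
      unfolding \<B>'_def by (meson add_mono card_Un_le le_refl le_trans)
    also have "\<dots> \<le> card \<B> + card \<B> + card (\<B> \<times> \<B>) + card (\<B> \<times> \<B>)"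
      using fin by (intro add_mono card_image_le) auto
    finally show ?thesis by (simp add: card_cartesian_product power2_eq_square)
  qed
  ultimately show ?thesis by blast
qed

text \<open>The factor 4 turns the recursion into squaring:
  \<open>4 * (2 * b + 2 * b\<^sup>2) \<le> (4 * b)\<^sup>2\<close> for natural
  \<open>b\<close>.\<close>

lemma bracketing_ops:
  assumes P: "finite P" "P \<subseteq> Rspace d" and N: "N \<ge> 1"
    and B: "is_bracketing P \<epsilon> {S. semialg_ops d \<Delta> 0 S} \<B>" "card \<B> \<le> N"
  shows "\<exists>\<B>'. is_bracketing P (2 ^ k * \<epsilon>) {S. \<exists>j\<le>k. semialg_ops d \<Delta> j S} \<B>' \<and>
    4 * card \<B>' \<le> (4 * N) ^ (2 ^ k)"
proof (induction k)
  case 0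
  then show ?case using B by (intro exI[of _ \<B>]) auto
next
  case (Suc k)
  then obtain \<B>1 where B1: "is_bracketing P (2 ^ k * \<epsilon>) {S. \<exists>j\<le>k. semialg_ops d \<Delta> j S} \<B>1"
    "4 * card \<B>1 \<le> (4 * N) ^ (2 ^ k)" by blast
  obtain \<B>2 where B2: "is_bracketing P (2 * (2 ^ k * \<epsilon>)) {S. \<exists>j\<le>Suc k. semialg_ops d \<Delta> j S} \<B>2"
    "card \<B>2 \<le> 2 * card \<B>1 + 2 * (card \<B>1)\<^sup>2"
    using bracketing_step[OF P B1(1)] by auto
  have "card \<B>1 \<le> (card \<B>1)\<^sup>2" by (simp add: power2_eq_square)
  then have "4 * card \<B>2 \<le> (4 * card \<B>1)\<^sup>2" using B2(2) by (simp add: power_mult_distrib)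
  also have "\<dots> \<le> ((4 * N) ^ (2 ^ k))\<^sup>2" using B1(2) by (rule power_mono) simp
  also have "\<dots> = (4 * N) ^ (2 ^ Suc k)" by (simp only: power_mult[symmetric] power_Suc mult.commute[of 2 "2 ^ k"])
  finally show ?case using B2(1) by (intro exI[of _ \<B>2]) (simp add: mult.assoc)
qed

text \<open>Brackets of the atoms with error \<open>\<epsilon> / 2 ^ s\<close> give brackets with
  error \<open>\<epsilon>\<close> after \<open>s\<close> operations; their lower ends are the
  approximations.\<close>

theorem semialg_inner_approximation:
  "\<exists>A k. A \<ge> 1 \<and> k \<ge> 1 \<and> (\<forall>P \<epsilon>. finite P \<and> P \<subseteq> Rspace d \<and> 0 < \<epsilon> \<and> \<epsilon> \<le> 1 \<longrightarrow>
     (\<exists>\<M>. finite \<M> \<and> real (card \<M>) \<le> A * (1/\<epsilon>) ^ k \<and>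
        (\<forall>S\<in>semialg_class d \<Delta> s. \<exists>M\<in>\<M>. M \<subseteq> S \<inter> P \<and> real (card (S \<inter> P - M)) \<le> \<epsilon> * real (card P))))"
proof -
  obtain A k where A: "(A::real) \<ge> 1" and br: "\<forall>P \<epsilon>. finite P \<and> P \<subseteq> Rspace d \<and> 0 < \<epsilon> \<and> \<epsilon> \<le> 1 \<longrightarrow>
     (\<exists>\<B>. is_bracketing P \<epsilon> {S. semialg_ops d \<Delta> 0 S} \<B> \<and> real (card \<B>) \<le> A * (1/\<epsilon>) ^ k)"
    using polynomial_bracketing[of d \<Delta>] by (elim exE conjE) (rule that)
  define q :: nat where "q = 2 ^ s"
  have q: "q \<ge> 1" by (simp add: q_def)
  \<comment> \<open>The 8 combines the 4 of \<open>bracketing_ops\<close> with the 2 lost in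
    rounding the number of brackets up to \<open>N\<close>.\<close>
  define A' where "A' = (8 * A * q ^ k) ^ q"
  have A': "A' \<ge> 1" unfolding A'_def using A q by (intro one_le_power) (auto intro!: mult_ge1_I)
  \<comment> \<open>\<open>Suc\<close> makes the exponent positive even for \<open>k = 0\<close>, so
    that a root of this order can be taken later.\<close>
  have "\<exists>\<M>. finite \<M> \<and> real (card \<M>) \<le> A' * (1/\<epsilon>) ^ Suc (k * q) \<and>
        (\<forall>S\<in>semialg_class d \<Delta> s. \<exists>M\<in>\<M>. M \<subseteq> S \<inter> P \<and> real (card (S \<inter> P - M)) \<le> \<epsilon> * real (card P))"
    if P: "finite P" "P \<subseteq> Rspace d" and \<epsilon>: "0 < \<epsilon>" "\<epsilon> \<le> 1" for P \<epsilon>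
  proof -
    have \<epsilon>': "0 < \<epsilon> / q" "\<epsilon> / q \<le> 1" using \<epsilon> q by (auto simp: field_simps)
    obtain \<B> where B: "is_bracketing P (\<epsilon> / q) {S. semialg_ops d \<Delta> 0 S} \<B>"
      "real (card \<B>) \<le> A * (1/(\<epsilon> / q)) ^ k"
      using br[rule_format, of P "\<epsilon> / q"] P \<epsilon>' by blast
    define x where "x = A * (q/\<epsilon>) ^ k"
    have x: "x \<ge> 1" unfolding x_def using A \<epsilon> q by (intro mult_ge1_I one_le_power) (auto simp: field_simps)
    define N where "N = nat \<lceil>x\<rceil>"
    have N: "N \<ge> 1" "real N \<le> 2 * x" "card \<B> \<le> N"
      using x B(2) unfolding N_def by (linarith, linarith, simp add: x_def, linarith)
    obtain \<B>' where B': "is_bracketing P (2 ^ s * (\<epsilon> / q)) {S. \<exists>j\<le>s. semialg_ops d \<Delta> j S} \<B>'"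
      "4 * card \<B>' \<le> (4 * N) ^ (2 ^ s)"
      using bracketing_ops[OF P N(1) B(1) N(3)] by blast
    have "real (card \<B>') \<le> real ((4 * N) ^ q)" using B'(2) unfolding q_def by linarith
    also have "\<dots> = (4 * real N) ^ q" by simp
    also have "\<dots> \<le> (8 * x) ^ q" using N by (intro power_mono) auto
    also have "\<dots> = A' * (1/\<epsilon>) ^ (k * q)"
      by (simp add: A'_def x_def power_mult_distrib power_divide power_mult)
    also have "\<dots> \<le> A' * (1/\<epsilon>) ^ Suc (k * q)"
      using A' \<epsilon> by (intro mult_left_mono power_increasing) auto
    finally have card: "real (card \<B>') \<le> A' * (1/\<epsilon>) ^ Suc (k * q)" .
    have fin: "finite \<B>'" using B' by (simp add: is_bracketing_def)
    have "real (card (fst ` \<B>')) \<le> A' * (1/\<epsilon>) ^ Suc (k * q)"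
      using card card_image_le[OF fin, of fst] by linarith
    moreover have "\<exists>M\<in>fst ` \<B>'. M \<subseteq> S \<inter> P \<and> real (card (S \<inter> P - M)) \<le> \<epsilon> * real (card P)"
      if S: "S \<in> semialg_class d \<Delta> s" for S
    proof -
      have "S \<in> {S. \<exists>j\<le>s. semialg_ops d \<Delta> j S}" using S by (simp add: semialg_class_def)
      from bspec[OF conjunct2[OF B'(1)[unfolded is_bracketing_def]] this]
      obtain L U where L: "(L, U) \<in> \<B>'" "L \<subseteq> S \<inter> P" "S \<inter> P \<subseteq> U" "U \<subseteq> P"
        "real (card (U - L)) \<le> 2 ^ s * (\<epsilon> / q) * real (card P)" by blast
      have "finite (U - L)" using L P by (meson finite_Diff finite_subset)
      then have "card (S \<inter> P - L) \<le> card (U - L)" using L by (intro card_mono) auto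
      moreover have "2 ^ s * (\<epsilon> / q) = \<epsilon>" by (simp add: q_def)
      ultimately have "real (card (S \<inter> P - L)) \<le> \<epsilon> * real (card P)" using L(5) by simp
      moreover have "L \<in> fst ` \<B>'" using L(1) by force
      ultimately show ?thesis using L(2) by blast
    qed
    ultimately show ?thesis using fin by (intro exI[of _ "fst ` \<B>'"]) simp
  qed
  then show ?thesis using A' by (intro exI[of _ A'] exI[of _ "Suc (k * q)"]) simp
qed

section \<open>Separating samples\<close>

lemma exists_le_average:
  fixes g :: "'b \<Rightarrow> real"
  assumes "finite S" "S \<noteq> {}" "(\<Sum>x\<in>S. g x) \<le> c * real (card S)"
  shows "\<exists>x\<in>S. g x \<le> c"
proof (rule ccontr)
  assume "\<not> ?thesis"
  then have "(\<Sum>x\<in>S. c) < (\<Sum>x\<in>S. g x)" using assms(1,2) by (intro sum_strict_mono) auto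
  then show False using assms(3) by (simp add: mult.commute)
qed

text \<open>The \<open>i\<close>-th point of a random sequence lies in \<open>R\<close> with
  probability \<open>|R| / |X|\<close>, written without division.\<close>

lemma card_PiE_coordinate:
  assumes "finite X" "R \<subseteq> X" "i < m"
  shows "card {f \<in> {..<m} \<rightarrow>\<^sub>E X. f i \<in> R} * card X = card R * card X ^ m"
proof -
  have "{f \<in> {..<m} \<rightarrow>\<^sub>E X. f i \<in> R} = Pi\<^sub>E {..<m} (\<lambda>j. if j = i then R else X)"
  proof (intro equalityI subsetI)
    fix f assume f: "f \<in> Pi\<^sub>E {..<m} (\<lambda>j. if j = i then R else X)"
    have "f j \<in> X" if "j < m" for j using PiE_mem[OF f, of j] that assms(2) by (auto split: if_splits)
    moreover have "f i \<in> R" using PiE_mem[OF f, of i] assms(3) by simp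
    ultimately show "f \<in> {f \<in> {..<m} \<rightarrow>\<^sub>E X. f i \<in> R}" using f by (auto simp: PiE_iff)
  qed (auto simp: PiE_iff)
  then have "card {f \<in> {..<m} \<rightarrow>\<^sub>E X. f i \<in> R} = (\<Prod>j<m. card (if j = i then R else X))"
    by (simp add: card_PiE)
  also have "\<dots> = card R * (\<Prod>j\<in>{..<m}-{i}. card X)"
    using assms(3) by (subst prod.remove[of _ i]) auto
  also have "\<dots> = card R * card X ^ (m - 1)" using assms(3) by simp
  finally show ?thesis using assms(3) by (cases m) auto
qed

text \<open>A uniformly random sequence of \<open>m\<close> points misses a symmetric difference of size \<open>\<delta>\<close> with
  probability at most \<open>(1 - \<delta>/n)^m\<close>, which allows a union bound over all pairs, and it meets most
  members of \<open>\<P>\<close> in few points by Markov's inequality.\<close>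

lemma separating_sample:
  fixes \<P> :: "'a set set" and X :: "'a set" and \<delta> \<tau> l :: real
  assumes X: "finite X" "X \<noteq> {}" and \<P>: "\<And>R. R \<in> \<P> \<Longrightarrow> R \<subseteq> X" "\<P> \<noteq> {}"
    and small: "\<And>R. R \<in> \<P> \<Longrightarrow> real (card R) \<le> \<tau> * real (card X)"
    and sep: "\<And>R R'. R \<in> \<P> \<Longrightarrow> R' \<in> \<P> \<Longrightarrow> R \<noteq> R' \<Longrightarrow> \<delta> \<le> real (card (sym_diff R R'))"
    and m: "(real (card \<P>))\<^sup>2 * (1 - \<delta> / real (card X)) ^ m \<le> 1/4" and \<delta>: "\<delta> \<le> real (card X)"
    and l: "0 < l" "4 * real m * \<tau> \<le> l"
  shows "\<exists>Y\<subseteq>X. card Y \<le> m \<and> (m > 0 \<longrightarrow> Y \<noteq> {}) \<and>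
    real (card \<P>) \<le> 2 * real (card {Z \<in> set_trace \<P> Y. real (card Z) \<le> l})"
proof -
  define n where "n = card X"
  have n: "n > 0" using X by (simp add: n_def card_gt_0_iff)
  have fin\<P>: "finite \<P>" using \<P>(1) X(1) by (auto intro: finite_subset[of _ "Pow X"])
  have p: "card \<P> > 0" using fin\<P> \<P>(2) by (simp add: card_gt_0_iff)
  define \<Omega> where "\<Omega> = {..<m} \<rightarrow>\<^sub>E X"
  have fin\<Omega>: "finite \<Omega>" and card\<Omega>: "card \<Omega> = n ^ m" using X by (simp_all add: \<Omega>_def finite_PiE card_PiE n_def)
  then have ne\<Omega>: "\<Omega> \<noteq> {}" using n by (metis card.empty power_eq_0_iff less_irrefl)
  define Q where "Q = {(R, R') \<in> \<P> \<times> \<P>. R \<noteq> R'}"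
  have finQ: "finite Q" using fin\<P> by (auto simp: Q_def intro: finite_subset[of _ "\<P> \<times> \<P>"])
  have cardQ: "card Q \<le> (card \<P>)\<^sup>2"
    using card_mono[of "\<P> \<times> \<P>" Q] fin\<P> by (auto simp: Q_def card_cartesian_product power2_eq_square)
  define miss where "miss q f \<longleftrightarrow> (\<forall>i<m. f i \<notin> sym_diff (fst q) (snd q))" for q :: "'a set \<times> 'a set" and f
  define hits where "hits R f = {i\<in>{..<m}. f i \<in> R}" for R :: "'a set" and f
  \<comment> \<open>\<open>U\<close> counts the pairs that the sequence fails to separate,
    \<open>V\<close> all hits with repetition. Their expectations are bounded by double
    counting.\<close>
  define U where "U f = card {q\<in>Q. miss q f}" for f
  define V where "V f = (\<Sum>R\<in>\<P>. card (hits R f))" for f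
  have U_sum: "(\<Sum>f\<in>\<Omega>. real (U f)) \<le> 1/4 * real (card \<Omega>)"
  proof -
    have one: "real (card {f\<in>\<Omega>. miss q f}) \<le> ((1 - \<delta> / n) * n) ^ m" if q: "q \<in> Q" for q
    proof -
      define D where "D = sym_diff (fst q) (snd q)"
      have D: "D \<subseteq> X" "\<delta> \<le> real (card D)"
      proof -
        have "fst q \<in> \<P>" "snd q \<in> \<P>" "fst q \<noteq> snd q" using q by (auto simp: Q_def)
        then show "D \<subseteq> X" "\<delta> \<le> real (card D)" using \<P>(1) sep unfolding D_def by blast+
      qed
      have "f \<in> \<Omega> \<and> miss q f \<longleftrightarrow> f \<in> {..<m} \<rightarrow>\<^sub>E (X - D)" for f
        unfolding \<Omega>_def miss_def D_def[symmetric] PiE_iff Diff_iff Ball_def lessThan_iff by blast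
      then have "{f\<in>\<Omega>. miss q f} = {..<m} \<rightarrow>\<^sub>E (X - D)" by blast
      then have "card {f\<in>\<Omega>. miss q f} = (n - card D) ^ m"
        using D(1) X(1) by (simp add: card_PiE card_Diff_subset finite_subset n_def)
      moreover have "real (n - card D) \<le> n - \<delta>"
        using D X(1) card_mono[of X D] by (simp add: n_def of_nat_diff)
      moreover have "(1 - \<delta> / n) * n = n - \<delta>" using n by (simp add: field_simps)
      ultimately show ?thesis by (simp add: power_mono)
    qed
    have "(\<Sum>f\<in>\<Omega>. U f) = (\<Sum>q\<in>Q. card {f\<in>\<Omega>. miss q f})"
      unfolding U_def by (rule sum_multicount_gen[OF fin\<Omega> finQ, where R = "\<lambda>f q. miss q f"]) (intro ballI refl)
    from arg_cong[OF this, of real]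
    have "(\<Sum>f\<in>\<Omega>. real (U f)) = (\<Sum>q\<in>Q. real (card {f\<in>\<Omega>. miss q f}))"
      by (simp only: of_nat_sum)
    also have "\<dots> \<le> real (card Q) * ((1 - \<delta> / n) * n) ^ m" using one by (rule sum_bounded_above)
    also have "\<dots> = (real (card Q) * (1 - \<delta> / n) ^ m) * n ^ m" by (simp add: power_mult_distrib)
    also have "\<dots> \<le> ((real (card \<P>))\<^sup>2 * (1 - \<delta> / n) ^ m) * n ^ m"
    proof (intro mult_right_mono)
      show "real (card Q) \<le> (real (card \<P>))\<^sup>2" using cardQ by (metis of_nat_le_iff of_nat_power)
      show "0 \<le> (1 - \<delta> / n) ^ m" using \<delta> n by (intro zero_le_power) (simp add: n_def)
    qed simp
    also have "\<dots> \<le> 1/4 * n ^ m" using m by (intro mult_right_mono) (auto simp: n_def)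
    finally show ?thesis by (simp add: card\<Omega>)
  qed
  have V_sum: "(\<Sum>f\<in>\<Omega>. real (V f) / (l * card \<P>)) \<le> 1/4 * real (card \<Omega>)"
  proof -
    have one: "real (\<Sum>f\<in>\<Omega>. card (hits R f)) \<le> l / 4 * n ^ m" if R: "R \<in> \<P>" for R
    proof -
      have "(\<Sum>f\<in>\<Omega>. card (hits R f)) = (\<Sum>i<m. card {f\<in>\<Omega>. f i \<in> R})"
        unfolding hits_def
        by (rule sum_multicount_gen[OF fin\<Omega> finite_lessThan, where R = "\<lambda>f i. f i \<in> R"]) (intro ballI refl)
      then have "(\<Sum>f\<in>\<Omega>. card (hits R f)) * n = (\<Sum>i<m. card {f\<in>\<Omega>. f i \<in> R} * n)"
        by (simp add: sum_distrib_right)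
      also have "\<dots> = (\<Sum>i<m. card R * n ^ m)"
        unfolding \<Omega>_def n_def using X(1) \<P>(1)[OF R] by (intro sum.cong card_PiE_coordinate) auto
      finally have "real (\<Sum>f\<in>\<Omega>. card (hits R f)) * n = real m * (card R * n ^ m)"
        by (metis card_lessThan of_nat_mult of_nat_power sum_constant of_nat_id)
      also have "\<dots> \<le> real m * ((\<tau> * n) * n ^ m)"
        unfolding of_nat_mult of_nat_power
        using small[OF R] by (intro mult_left_mono mult_right_mono) (auto simp: n_def)
      finally have "real (\<Sum>f\<in>\<Omega>. card (hits R f)) * n \<le> (real m * \<tau> * n ^ m) * n"
        by (simp add: algebra_simps)
      then have "real (\<Sum>f\<in>\<Omega>. card (hits R f)) \<le> real m * \<tau> * n ^ m"
        using n by (simp only: mult_le_cancel_right_pos of_nat_0_less_iff)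
      also have "\<dots> \<le> l / 4 * n ^ m" using l by (intro mult_right_mono) auto
      finally show ?thesis .
    qed
    have "(\<Sum>f\<in>\<Omega>. real (V f)) = (\<Sum>R\<in>\<P>. real (\<Sum>f\<in>\<Omega>. card (hits R f)))"
      unfolding V_def of_nat_sum by (rule sum.swap)
    also have "\<dots> \<le> card \<P> * (l / 4 * n ^ m)" using one by (rule sum_bounded_above)
    finally show ?thesis using l p by (simp add: sum_divide_distrib[symmetric] card\<Omega> field_simps)
  qed
  \<comment> \<open>Some sequence is no worse than the average 1/2. The natural number
    \<open>U f\<close> is then 0, and \<open>V f\<close> is at most half of
    \<open>l * card \<P>\<close>.\<close>
  have "(\<Sum>f\<in>\<Omega>. real (U f) + real (V f) / (l * card \<P>)) \<le> 1/2 * real (card \<Omega>)"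
    using U_sum V_sum by (simp add: sum.distrib)
  then obtain f where f: "f \<in> \<Omega>" "real (U f) + real (V f) / (l * card \<P>) \<le> 1/2"
    using exists_le_average[OF fin\<Omega> ne\<Omega>] by blast
  have V0: "real (V f) / (l * card \<P>) \<ge> 0" using l by simp
  then have U0: "U f = 0" using f(2) by linarith
  then have nomiss: "\<not> miss q f" if "q \<in> Q" for q
    using that U0 finQ by (cases q) (auto simp: U_def)
  define Y where "Y = f ` {..<m}"
  have YX: "Y \<subseteq> X" using f(1) by (auto simp: Y_def \<Omega>_def)
  have finY: "finite Y" by (simp add: Y_def)
  have Vf: "real (V f) \<le> l * card \<P> / 2" using f(2) U0 l p by (simp add: field_simps)
  define S where "S = {R\<in>\<P>. real (card (R \<inter> Y)) \<le> l}"
  \<comment> \<open>Markov's inequality for this sequence: hits count repetitions and hence dominate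
    \<open>card (R \<inter> Y)\<close>, so at most half of \<open>\<P>\<close> lies outside
    \<open>S\<close>.\<close>
  have "l * real (card (\<P> - S)) \<le> (\<Sum>R\<in>\<P> - S. real (card (hits R f)))"
  proof -
    have "l \<le> real (card (hits R f))" if "R \<in> \<P> - S" for R
    proof -
      have "R \<inter> Y = f ` hits R f" by (auto simp: Y_def hits_def)
      then have "card (R \<inter> Y) \<le> card (hits R f)" by (simp add: card_image_le hits_def)
      then show ?thesis using that by (auto simp: S_def)
    qed
    then have "(\<Sum>R\<in>\<P> - S. l) \<le> (\<Sum>R\<in>\<P> - S. real (card (hits R f)))" by (rule sum_mono)
    then show ?thesis by (simp add: mult.commute)
  qed
  also have "\<dots> \<le> real (V f)" unfolding V_def of_nat_sum using fin\<P> by (intro sum_mono2) auto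
  also note Vf
  finally have "real (card (\<P> - S)) \<le> card \<P> / 2" using l by (simp add: field_simps)
  moreover have "card (\<P> - S) = card \<P> - card S" "card S \<le> card \<P>"
    using fin\<P> by (auto simp: S_def intro!: card_Diff_subset card_mono)
  ultimately have "real (card \<P>) \<le> 2 * real (card S)" by linarith
  moreover have "card S \<le> card {Z \<in> set_trace \<P> Y. real (card Z) \<le> l}"
  proof (rule card_inj_on_le)
    show "inj_on (\<lambda>R. R \<inter> Y) S"
    proof (rule inj_onI, rule ccontr)
      fix R R' assume R: "R \<in> S" "R' \<in> S" "R \<inter> Y = R' \<inter> Y" "R \<noteq> R'"
      then have "(R, R') \<in> Q" by (simp add: Q_def S_def)
      from nomiss[OF this] obtain i where "i < m" "f i \<in> sym_diff R R'" by (auto simp: miss_def)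
      then show False using R(3) by (auto simp: Y_def)
    qed
    show "(\<lambda>R. R \<inter> Y) ` S \<subseteq> {Z \<in> set_trace \<P> Y. real (card Z) \<le> l}"
      by (auto simp: S_def set_trace_def)
    show "finite {Z \<in> set_trace \<P> Y. real (card Z) \<le> l}"
      using finY by (auto intro!: finite_subset[of _ "Pow Y"] simp: set_trace_def)
  qed
  moreover have "card Y \<le> m" using card_image_le[of "{..<m}" f] by (simp add: Y_def)
  moreover have "m > 0 \<longrightarrow> Y \<noteq> {}" by (auto simp: Y_def)
  ultimately show ?thesis using YX by (intro exI[of _ Y]) linarith+
qed

text \<open>Greedy choice: an element is added exactly when it is not related to an earlier choice.
  The relation need not be transitive, as closeness of sets is not.\<close>

lemma maximal_packing:
  assumes "finite S" "\<And>x. r x x" "\<And>x y. r x y \<Longrightarrow> r y x"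
  shows "\<exists>T\<subseteq>S. (\<forall>x\<in>T. \<forall>y\<in>T. x \<noteq> y \<longrightarrow> \<not> r x y) \<and> (\<forall>x\<in>S. \<exists>y\<in>T. r x y)"
  using assms(1)
proof induction
  case (insert x S)
  then obtain T where T: "T \<subseteq> S" "\<forall>x\<in>T. \<forall>y\<in>T. x \<noteq> y \<longrightarrow> \<not> r x y" "\<forall>x\<in>S. \<exists>y\<in>T. r x y"
    by blast
  show ?case
  proof (cases "\<exists>y\<in>T. r x y")
    case True
    then show ?thesis using T by (intro exI[of _ T]) blast
  next
    case False
    then have "\<forall>a\<in>insert x T. \<forall>b\<in>insert x T. a \<noteq> b \<longrightarrow> \<not> r a b" using T(2) assms(3) by blast
    moreover have "\<forall>a\<in>insert x S. \<exists>b\<in>insert x T. r a b" using T(3) assms(2) by blast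
    ultimately show ?thesis using T(1) by (intro exI[of _ "insert x T"]) blast
  qed
qed simp

lemma power_div_le_exp:
  fixes x :: real
  assumes "0 \<le> x" "0 < j"
  shows "(x / real j) ^ j \<le> exp x"
proof -
  have "(x / j) ^ j \<le> exp (x / j) ^ j"
    using assms less_imp_le[OF exp_gt_self[of "x / j"]] by (intro power_mono) auto
  also have "\<dots> = exp x" using assms by (simp add: exp_of_nat_mult[symmetric])
  finally show ?thesis .
qed

text \<open>The union bound for packings: their size is polynomial in \<open>1/\<tau>\<close>, while
  the probability of failure decays like \<open>exp (- \<mu> / (2 * \<tau>))\<close>. The degree
  \<open>j\<close> exceeds the degree \<open>2 * k\<^sup>2\<close> by one, and the spare factor
  \<open>\<tau>\<close> beats the constants and powers of \<open>1/\<mu>\<close> by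
  \<open>thr\<close>.\<close>

lemma sample_size_suffices:
  fixes A \<mu> \<tau> :: real and k j m :: nat
  assumes A: "A \<ge> 1" and k: "k \<ge> 1" and \<mu>: "0 < \<mu>" "\<mu> \<le> 1" and \<tau>: "0 < \<tau>" "\<tau> < 1"
    and j: "j = 2 * k\<^sup>2 + 1" and thr: "\<tau> * (real (2 * j) ^ j * (4 * A\<^sup>2 * 64 ^ k)) \<le> \<mu> ^ (j + 2 * k)"
    and m: "3 / (\<tau> ^ k * \<tau>) - 1 \<le> real m"
  shows "(A * (8 / (\<mu> * \<tau> ^ k)) ^ k)\<^sup>2 * (1 - \<mu> * \<tau> ^ k / 4) ^ m \<le> 1/4"
proof -
  define \<eta> where "\<eta> = \<tau> ^ k"
  have \<eta>: "0 < \<eta>" "\<eta> \<le> 1" using \<tau> by (auto simp: \<eta>_def power_le_one)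
  have \<mu>\<eta>: "\<mu> * \<eta> \<le> 1" using \<mu> \<eta> by (simp add: mult_le_one)
  \<comment> \<open>The 3 drops to 2 because rounding \<open>m\<close> down costs at most
    \<open>\<eta> \<le> 1 / \<tau>\<close>.\<close>
  have "2 / \<tau> \<le> m * \<eta>"
  proof -
    have "(3 / (\<eta> * \<tau>) - 1) * \<eta> \<le> m * \<eta>" using m \<eta> by (intro mult_right_mono) (auto simp: \<eta>_def)
    moreover have "(3 / (\<eta> * \<tau>) - 1) * \<eta> = 3 / \<tau> - \<eta>" using \<eta> \<tau> by (simp add: field_simps)
    moreover have "\<eta> \<le> 1 / \<tau>" using \<eta> \<tau> by (simp add: field_simps) (meson less_imp_le mult_le_one order.trans)
    moreover have "3 / \<tau> = 3 * (1 / \<tau>)" "2 / \<tau> = 2 * (1 / \<tau>)" by simp_all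
    ultimately show ?thesis by linarith
  qed
  define y where "y = \<mu> / (2 * \<tau>)"
  have y: "y > 0" "y \<le> m * (\<mu> * \<eta> / 4)"
    using \<open>2 / \<tau> \<le> m * \<eta>\<close> \<mu> \<tau> by (auto simp: y_def field_simps)
  have "(1 - \<mu> * \<eta> / 4) ^ m \<le> exp (- (\<mu> * \<eta> / 4)) ^ m"
    using exp_ge_add_one_self[of "- (\<mu> * \<eta> / 4)"] \<mu>\<eta> by (intro power_mono) auto
  also have "\<dots> = exp (- (m * (\<mu> * \<eta> / 4)))" by (simp add: exp_of_nat_mult[symmetric])
  also have "\<dots> \<le> exp (- y)" using y by simp
  finally have tail: "(1 - \<mu> * \<eta> / 4) ^ m \<le> exp (- y)" .
  define N where "N = A * (8 / (\<mu> * \<eta>)) ^ k"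
  have "4 * N\<^sup>2 \<le> (y / j) ^ j"
  proof -
    have N2: "4 * N\<^sup>2 * (\<mu> ^ (2 * k) * \<tau> ^ (2 * k\<^sup>2)) = 4 * A\<^sup>2 * 64 ^ k"
    proof -
      have "N * (\<mu> ^ k * \<eta> ^ k) = A * 8 ^ k" using \<mu> \<eta> by (simp add: N_def power_divide power_mult_distrib)
      then have "(N * (\<mu> ^ k * \<eta> ^ k))\<^sup>2 = (A * 8 ^ k)\<^sup>2" by simp
      moreover have "(8 ^ k)\<^sup>2 = (64 :: real) ^ k" by (simp add: power2_eq_square power_mult_distrib[symmetric])
      moreover have "(\<mu> ^ k)\<^sup>2 = \<mu> ^ (2 * k)" "(\<eta> ^ k)\<^sup>2 = \<tau> ^ (2 * k\<^sup>2)"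
        by (simp_all add: \<eta>_def power_mult[symmetric] power_add[symmetric] power2_eq_square mult_2)
      ultimately show ?thesis by (simp add: power_mult_distrib)
    qed
    have yj: "(y / j) ^ j * (real (2 * j) ^ j * \<tau> ^ j) = \<mu> ^ j"
    proof -
      have "j > 0" by (simp add: j)
      then have "(y / j) * (real (2 * j) * \<tau>) = \<mu>" using \<tau> by (simp add: y_def field_simps)
      then show ?thesis by (metis power_mult_distrib)
    qed
    \<comment> \<open>Both sides are multiplied by a common positive factor that clears all negative
      powers of \<open>\<mu>\<close> and \<open>\<tau>\<close>.\<close>
    have "(4 * N\<^sup>2) * (\<mu> ^ (2 * k) * (real (2 * j) ^ j * \<tau> ^ j))
        = (4 * N\<^sup>2 * (\<mu> ^ (2 * k) * \<tau> ^ (2 * k\<^sup>2))) * (\<tau> * real (2 * j) ^ j)"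
      by (simp add: j)
    also have "\<dots> = \<tau> * (real (2 * j) ^ j * (4 * A\<^sup>2 * 64 ^ k))" unfolding N2 by simp
    also have "\<dots> \<le> \<mu> ^ j * \<mu> ^ (2 * k)" using thr by (simp add: power_add)
    also have "\<dots> = (y / j) ^ j * (\<mu> ^ (2 * k) * (real (2 * j) ^ j * \<tau> ^ j))" unfolding yj[symmetric] by simp
    finally have le: "(4 * N\<^sup>2) * (\<mu> ^ (2 * k) * (real (2 * j) ^ j * \<tau> ^ j))
        \<le> (y / j) ^ j * (\<mu> ^ (2 * k) * (real (2 * j) ^ j * \<tau> ^ j))" .
    have "0 < real (2 * j)" unfolding of_nat_0_less_iff by (simp add: j)
    from le show ?thesis
    proof (rule mult_right_le_imp_le)
      show "0 < \<mu> ^ (2 * k) * (real (2 * j) ^ j * \<tau> ^ j)" using \<mu> \<tau> \<open>0 < real (2 * j)\<close> by (intro mult_pos_pos zero_less_power)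
    qed
  qed
  also have "\<dots> \<le> exp y" using y j by (intro power_div_le_exp) auto
  finally have "4 * N\<^sup>2 * exp (- y) \<le> 1" by (simp add: exp_minus field_simps)
  moreover have "N\<^sup>2 * (1 - \<mu> * \<eta> / 4) ^ m \<le> N\<^sup>2 * exp (- y)" using tail by (rule mult_left_mono) simp
  ultimately show ?thesis unfolding N_def \<eta>_def by linarith
qed

section \<open>Mnets\<close>

text \<open>Approximations relative to every \<open>P\<close>, not just \<open>X\<close>, are
  required: with a member of the system as \<open>P\<close>, the error is proportional to that
  member.\<close>

locale approximable_system =
  fixes A :: real and k :: nat and X :: "'a set" and \<R> :: "'a set set"
  assumes X: "finite X" "X \<noteq> {}" and \<R>: "\<R> \<subseteq> Pow X" and A: "A \<ge> 1" and k: "k \<ge> 1"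
    and inner_approximation: "P \<subseteq> X \<Longrightarrow> 0 < \<epsilon> \<Longrightarrow> \<epsilon> \<le> 1 \<Longrightarrow>
      \<exists>\<M>. finite \<M> \<and> real (card \<M>) \<le> A * (1/\<epsilon>) ^ k \<and>
        (\<forall>R\<in>\<R>. \<exists>M\<in>\<M>. M \<subseteq> R \<inter> P \<and> real (card (R \<inter> P - M)) \<le> \<epsilon> * real (card P))"
begin

lemma finite_members: "R \<in> \<R> \<Longrightarrow> finite R"
  using \<R> X(1) by (auto intro: finite_subset)

lemma global_approximation:
  assumes "0 < \<epsilon>" "\<epsilon> \<le> 1"
  shows "\<exists>\<M>. finite \<M> \<and> real (card \<M>) \<le> A * (1/\<epsilon>) ^ k \<and>
    (\<forall>R\<in>\<R>. \<exists>M\<in>\<M>. M \<subseteq> R \<and> real (card R) \<le> real (card M) + \<epsilon> * real (card X))"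
proof -
  obtain \<M> where M: "finite \<M>" "real (card \<M>) \<le> A * (1/\<epsilon>) ^ k"
    "\<forall>R\<in>\<R>. \<exists>M\<in>\<M>. M \<subseteq> R \<inter> X \<and> real (card (R \<inter> X - M)) \<le> \<epsilon> * real (card X)"
    using inner_approximation[OF subset_refl assms] by (elim exE conjE) (rule that)
  have "\<exists>M\<in>\<M>. M \<subseteq> R \<and> real (card R) \<le> real (card M) + \<epsilon> * real (card X)" if R: "R \<in> \<R>" for R
  proof -
    obtain M where M': "M \<in> \<M>" "M \<subseteq> R \<inter> X" "real (card (R \<inter> X - M)) \<le> \<epsilon> * real (card X)"
      using bspec[OF M(3) R] by blast
    have "R \<inter> X = R" using R \<R> by blast
    moreover have "card R = card (R - M) + card M"
      using M'(2) finite_members[OF R] card_Un_disjoint[of "R - M" M]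
      by (metis Diff_disjoint Diff_partition Int_commute Un_commute finite_Diff finite_subset le_inf_iff)
    ultimately show ?thesis using M' by (intro bexI[of _ M]) auto
  qed
  then show ?thesis using M by blast
qed

text \<open>Candidates need not lie inside \<open>X\<close>; those that do not are discarded, and no
  witness is lost because members are subsets of \<open>X\<close>.\<close>

lemma heavy_MnetI:
  assumes "finite \<M>" "real (card \<M>) \<le> c"
    and cover: "\<And>R. R \<in> \<R> \<Longrightarrow> \<eta> * real (card X) \<le> real (card R) \<Longrightarrow>
      \<exists>M\<in>\<M>. M \<subseteq> R \<and> lam * real (card R) \<le> real (card M)"
  shows "\<exists>\<M>. heavy_Mnet lam \<eta> X \<R> \<M> \<and> real (card \<M>) \<le> c"
proof (intro exI[of _ "\<M> \<inter> Pow X"] conjI)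
  show "heavy_Mnet lam \<eta> X \<R> (\<M> \<inter> Pow X)"
    unfolding heavy_Mnet_def
  proof (intro conjI ballI impI)
    fix R assume R: "R \<in> \<R>" "\<eta> * real (card X) \<le> real (card R)"
    from cover[OF this] obtain M where "M \<in> \<M>" "M \<subseteq> R" "lam * real (card R) \<le> real (card M)"
      by blast
    then show "\<exists>M\<in>\<M> \<inter> Pow X. M \<subseteq> R \<and> lam * real (card R) \<le> real (card M)"
      using R(1) \<R> by (intro bexI[of _ M]) auto
  qed simp
  have "card (\<M> \<inter> Pow X) \<le> card \<M>" using assms(1) by (intro card_mono) auto
  then show "real (card (\<M> \<inter> Pow X)) \<le> c" using assms(2) by linarith
qed

text \<open>Two sets with a common inner approximation are close, so a packing injects into the approximations.\<close>

lemma packing_size: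
  assumes \<epsilon>: "0 < \<epsilon>" "\<epsilon> \<le> 1" and P: "\<P> \<subseteq> \<R>"
    and sep: "\<And>R R'. R \<in> \<P> \<Longrightarrow> R' \<in> \<P> \<Longrightarrow> R \<noteq> R' \<Longrightarrow> 2 * \<epsilon> * real (card X) < real (card (sym_diff R R'))"
  shows "real (card \<P>) \<le> A * (1/\<epsilon>) ^ k"
proof -
  obtain \<M> where M: "finite \<M>" "real (card \<M>) \<le> A * (1/\<epsilon>) ^ k"
    "\<forall>R\<in>\<R>. \<exists>M\<in>\<M>. M \<subseteq> R \<and> real (card R) \<le> real (card M) + \<epsilon> * real (card X)"
    using global_approximation[OF \<epsilon>] by (elim exE conjE) (rule that)
  have "\<forall>R\<in>\<R>. \<exists>M. M \<in> \<M> \<and> M \<subseteq> R \<and> real (card R) \<le> real (card M) + \<epsilon> * real (card X)"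
    using M(3) by blast
  from bchoice[OF this] obtain f where
    f: "\<forall>R\<in>\<R>. f R \<in> \<M> \<and> f R \<subseteq> R \<and> real (card R) \<le> real (card (f R)) + \<epsilon> * real (card X)" ..
  have gap: "real (card (R - f R)) \<le> \<epsilon> * real (card X)" if R: "R \<in> \<R>" for R
  proof -
    have fR: "f R \<subseteq> R" "real (card R) \<le> real (card (f R)) + \<epsilon> * real (card X)" using f R by auto
    have "finite (f R)" using fR finite_members[OF R] finite_subset by blast
    then have "card (R - f R) = card R - card (f R)" using fR by (intro card_Diff_subset)
    moreover have "card (f R) \<le> card R" using fR finite_members[OF R] by (intro card_mono)
    ultimately show ?thesis using fR by (simp add: of_nat_diff)
  qed
  have "inj_on f \<P>"
  proof (rule inj_onI, rule ccontr)
    fix R R' assume R: "R \<in> \<P>" "R' \<in> \<P>" "f R = f R'" "R \<noteq> R'"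
    then have RR: "R \<in> \<R>" "R' \<in> \<R>" using P by auto
    have "f R \<subseteq> R" "f R' \<subseteq> R'" using f RR by auto
    then have "sym_diff R R' \<subseteq> (R - f R) \<union> (R' - f R')" using R(3) by blast
    then have "card (sym_diff R R') \<le> card ((R - f R) \<union> (R' - f R'))"
      using RR finite_members by (intro card_mono) auto
    also have "\<dots> \<le> card (R - f R) + card (R' - f R')" by (rule card_Un_le)
    finally show False using gap[OF RR(1)] gap[OF RR(2)] sep[OF R(1,2,4)] by linarith
  qed
  then have "card \<P> \<le> card \<M>" using f P M(1) by (intro card_inj_on_le[of f]) auto
  then show ?thesis using M(2) by linarith
qed

end

section \<open>Packings of small members, and the Mnet built from them\<close>

text \<open>\<open>D\<close> stands for the VC dimension and \<open>\<mu>\<close> for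
  \<open>1 - lam\<close>. Taking \<open>\<eta> = \<tau> ^ k\<close> makes
  \<open>A * (1/\<tau>) ^ k\<close> equal to \<open>A / \<eta>\<close>, an affordable price for the
  members larger than \<open>\<tau> * |X|\<close>.\<close>

locale shallow_system = approximable_system +
  fixes \<psi> :: "real \<Rightarrow> real \<Rightarrow> real" and D \<mu> \<eta> \<tau> :: real
  assumes scc: "has_shallow_cell_complexity X \<R> \<psi>" and mono: "nondecreasing2 \<psi>"
    and D: "D \<ge> 1" and \<mu>: "0 < \<mu>" "\<mu> < 1" and \<tau>: "0 < \<tau>" "\<tau> < 1" and \<eta>: "\<eta> = \<tau> ^ k"
    and psi1: "1 \<le> \<psi> (4 * D / \<eta>\<^sup>2) (15 * D / \<eta>)"
begin

abbreviation "psi \<equiv> \<psi> (4 * D / \<eta>\<^sup>2) (15 * D / \<eta>)"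
text \<open>\<open>J\<close> and \<open>Z\<close> are the degree \<open>j\<close> and the constant
  in \<open>thr\<close> of \<open>sample_size_suffices\<close>.\<close>

abbreviation "J \<equiv> 2 * k\<^sup>2 + 1"
abbreviation "Z \<equiv> real (2 * J) ^ J * (4 * A\<^sup>2 * 64 ^ k)"

lemma \<eta>_bounds: "0 < \<eta>" "\<eta> < 1" "\<eta> \<le> \<tau>"
proof -
  show "0 < \<eta>" using \<tau> by (simp add: \<eta>)
  show "\<eta> \<le> \<tau>" using \<tau> k power_decreasing[of 1 k \<tau>] by (simp add: \<eta>)
  then show "\<eta> < 1" using \<tau> by simp
qed

lemma Z_ge: "Z \<ge> 1"
proof -
  have "A\<^sup>2 \<ge> 1" using A by (simp add: one_le_power)
  moreover have "(64 :: real) ^ k \<ge> 1" by simp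
  ultimately have "1 * 1 \<le> A\<^sup>2 * (64 :: real) ^ k" by (intro mult_mono) auto
  moreover have "real (2 * J) ^ J \<ge> 1" by (intro one_le_power) simp
  ultimately have "1 * 1 \<le> real (2 * J) ^ J * (4 * A\<^sup>2 * 64 ^ k)" by (intro mult_mono) auto
  then show ?thesis by simp
qed

lemma shallow_packing_size:
  assumes thr: "\<tau> * Z \<le> \<mu> ^ (J + 2 * k)"
    and P: "\<P> \<subseteq> \<R>" and small: "\<And>R. R \<in> \<P> \<Longrightarrow> real (card R) \<le> \<tau> * real (card X)"
    and sep: "\<And>R R'. R \<in> \<P> \<Longrightarrow> R' \<in> \<P> \<Longrightarrow> R \<noteq> R' \<Longrightarrow> \<mu> * \<eta> / 4 * real (card X) < real (card (sym_diff R R'))"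
  shows "real (card \<P>) \<le> 6 / \<eta>\<^sup>2 * psi"
proof (cases "\<P> = {}")
  case True
  then show ?thesis using psi1 by simp
next
  case False
  note e = \<eta>_bounds
  have n: "real (card X) > 0" using X by (simp add: card_gt_0_iff)
  have \<mu>\<eta>: "0 < \<mu> * \<eta>" "\<mu> * \<eta> \<le> 1" using \<mu> e by (auto intro: mult_le_one)
  \<comment> \<open>This cruder bound, at scale \<open>\<mu> * \<eta> / 8\<close> because
    \<open>packing_size\<close> needs twice its scale as separation, only feeds the union bound over
    pairs.\<close>
  have "real (card \<P>) \<le> A * (1 / (\<mu> * \<eta> / 8)) ^ k"
  proof (rule packing_size[OF _ _ P])
    show "2 * (\<mu> * \<eta> / 8) * real (card X) < real (card (sym_diff R R'))"
      if "R \<in> \<P>" "R' \<in> \<P>" "R \<noteq> R'" for R R'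
    proof -
      have "2 * (\<mu> * \<eta> / 8) * real (card X) = \<mu> * \<eta> / 4 * real (card X)" by simp
      then show ?thesis using sep[OF that] by linarith
    qed
  qed (use \<mu>\<eta> in auto)
  then have cP: "real (card \<P>) \<le> A * (8 / (\<mu> * \<tau> ^ k)) ^ k" by (simp add: \<eta>)
  \<comment> \<open>A member holds at most a fraction \<open>\<tau>\<close> of \<open>X\<close>, so
    the expected number of its hits is at most \<open>3 / \<eta>\<close>; Markov's inequality at
    four times this value gives the depth \<open>12 / \<eta>\<close>.\<close>
  define m where "m = nat \<lfloor>3 / (\<eta> * \<tau>)\<rfloor>"
  have "3 / (\<eta> * \<tau>) > 1"
  proof -
    have "\<eta> * \<tau> \<le> 1" using e \<tau> by (intro mult_le_one) auto
    then show ?thesis using e \<tau> by (simp add: less_divide_eq)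
  qed
  then have m: "real m \<le> 3 / (\<eta> * \<tau>)" "3 / (\<eta> * \<tau>) - 1 \<le> real m" "m > 0"
    unfolding m_def by (linarith, linarith, linarith)
  have "(A * (8 / (\<mu> * \<tau> ^ k)) ^ k)\<^sup>2 * (1 - \<mu> * \<tau> ^ k / 4) ^ m \<le> 1/4"
    using m(2) \<mu> thr by (intro sample_size_suffices[OF A k _ _ \<tau> refl]) (auto simp: \<eta>)
  moreover have "(real (card \<P>))\<^sup>2 \<le> (A * (8 / (\<mu> * \<tau> ^ k)) ^ k)\<^sup>2" using cP by (intro power_mono) auto
  moreover have "0 \<le> (1 - \<mu> * \<tau> ^ k / 4) ^ m" using \<mu>\<eta> by (intro zero_le_power) (simp add: \<eta>)
  ultimately have m4: "(real (card \<P>))\<^sup>2 * (1 - \<mu> * \<tau> ^ k / 4) ^ m \<le> 1/4"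
    by (meson mult_right_mono order.trans)
  have "\<exists>Y\<subseteq>X. card Y \<le> m \<and> (m > 0 \<longrightarrow> Y \<noteq> {}) \<and>
    real (card \<P>) \<le> 2 * real (card {Z \<in> set_trace \<P> Y. real (card Z) \<le> 12 / \<eta>})"
  proof (rule separating_sample[OF X _ False small])
    show "R \<subseteq> X" if "R \<in> \<P>" for R using that P \<R> by auto
    show "\<mu> * \<eta> / 4 * real (card X) \<le> real (card (sym_diff R R'))" if "R \<in> \<P>" "R' \<in> \<P>" "R \<noteq> R'" for R R'
      using sep[OF that] by simp
    show "(real (card \<P>))\<^sup>2 * (1 - \<mu> * \<eta> / 4 * real (card X) / real (card X)) ^ m \<le> 1 / 4"
      using m4 n by (simp add: \<eta>)
    show "\<mu> * \<eta> / 4 * real (card X) \<le> real (card X)" using \<mu>\<eta> n by simp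
    show "0 < 12 / \<eta>" using e by simp
    have "m * \<tau> \<le> 3 / (\<eta> * \<tau>) * \<tau>" using m \<tau> by (intro mult_right_mono) auto
    then show "4 * real m * \<tau> \<le> 12 / \<eta>" using \<tau> by simp
  qed
  then obtain Y where Y: "Y \<subseteq> X" "card Y \<le> m" "Y \<noteq> {}"
    "real (card \<P>) \<le> 2 * real (card {Z \<in> set_trace \<P> Y. real (card Z) \<le> 12 / \<eta>})" using m(3) by blast
  have finY: "finite Y" using Y(1) X(1) finite_subset by blast
  \<comment> \<open>Shallow cell complexity speaks only of integers up to \<open>card Y\<close>,
    hence the floor and the minimum.\<close>
  define l where "l = min (card Y) (nat \<lfloor>12 / \<eta>\<rfloor>)"
  have sub: "{Z \<in> set_trace \<P> Y. real (card Z) \<le> 12 / \<eta>} \<subseteq> {Z \<in> set_trace \<R> Y. card Z \<le> l}"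
  proof
    fix T assume T: "T \<in> {Z \<in> set_trace \<P> Y. real (card Z) \<le> 12 / \<eta>}"
    then have "T \<subseteq> Y" "T \<in> set_trace \<R> Y" using P by (auto simp: set_trace_def)
    moreover have "card T \<le> nat \<lfloor>12 / \<eta>\<rfloor>" using T by (simp add: le_nat_floor)
    ultimately show "T \<in> {Z \<in> set_trace \<R> Y. card Z \<le> l}" using finY by (simp add: l_def card_mono)
  qed
  have "finite {Z \<in> set_trace \<R> Y. card Z \<le> l}"
    using finY by (auto intro!: finite_subset[of _ "Pow Y"] simp: set_trace_def)
  then have bound: "real (card \<P>) \<le> 2 * real (card {Z \<in> set_trace \<R> Y. card Z \<le> l})"
    using Y(4) card_mono[OF _ sub] by linarith
  have "l \<le> card Y" by (simp add: l_def)
  then have "real (card {Z \<in> set_trace \<R> Y. card Z \<le> l}) \<le> real (card Y) * \<psi> (real (card Y)) (real l)"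
    using scc Y(1,3) finY unfolding has_shallow_cell_complexity_def by blast
  also have "\<dots> \<le> 3 / \<eta>\<^sup>2 * psi"
  proof -
    \<comment> \<open>Since \<open>\<eta> \<le> \<tau>\<close>, the sample has at most
      \<open>3 / \<eta>\<^sup>2\<close> points. The factor 2 of \<open>separating_sample\<close>
      later makes this 6.\<close>
    have "3 / (\<eta> * \<tau>) \<le> 3 / \<eta>\<^sup>2"
      using e \<tau> by (intro divide_left_mono) (auto simp: power2_eq_square)
    then have cY: "real (card Y) \<le> 3 / \<eta>\<^sup>2" using m Y(2) by linarith
    also have "\<dots> \<le> 4 * D / \<eta>\<^sup>2" using D by (intro divide_right_mono) auto
    finally have "real (card Y) \<le> 4 * D / \<eta>\<^sup>2" .
    moreover have "real l \<le> 15 * D / \<eta>"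
    proof -
      have "real l \<le> real (nat \<lfloor>12 / \<eta>\<rfloor>)" by (simp add: l_def)
      also have "\<dots> \<le> 12 / \<eta>" using e by simp
      also have "\<dots> \<le> 15 * D / \<eta>" using D e by (intro divide_right_mono) auto
      finally show ?thesis .
    qed
    ultimately have "\<psi> (real (card Y)) (real l) \<le> psi" using mono unfolding nondecreasing2_def by simp
    then have "real (card Y) * \<psi> (real (card Y)) (real l) \<le> real (card Y) * psi" by (intro mult_left_mono) auto
    also have "\<dots> \<le> 3 / \<eta>\<^sup>2 * psi" using cY psi1 by (intro mult_right_mono) auto
    finally show ?thesis .
  qed
  finally show ?thesis using bound by simp
qed

text \<open>A member \<open>R\<close> is served by a close packing member \<open>P\<close>: it loses
  at most \<open>\<mu>/4 * |R|\<close> in passing to \<open>R \<inter> P\<close> and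
  \<open>\<mu>/4 * |P| \<le> \<mu>/2 * |R|\<close> in the approximation, together less than
  \<open>\<mu> * |R|\<close> unless \<open>R\<close> is empty.\<close>

lemma small_members:
  assumes thr: "\<tau> * Z \<le> \<mu> ^ (J + 2 * k)"
  shows "\<exists>\<M>. finite \<M> \<and> real (card \<M>) \<le> (6 / \<eta>\<^sup>2 * psi) * (A * (4 / \<mu>) ^ k) \<and>
    (\<forall>R\<in>\<R>. \<eta> * real (card X) \<le> real (card R) \<and> real (card R) \<le> \<tau> * real (card X) \<longrightarrow>
       (\<exists>M\<in>\<M>. M \<subseteq> R \<and> (1 - \<mu>) * real (card R) \<le> real (card M)))"
proof -
  note e = \<eta>_bounds
  define n where "n = real (card X)"
  define S where "S = {R\<in>\<R>. \<eta> * n \<le> real (card R) \<and> real (card R) \<le> \<tau> * n}"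
  \<comment> \<open>As \<open>|R| \<ge> \<eta> * n\<close> in \<open>S\<close>, this distance is at
    most \<open>\<mu>/4 * |R|\<close>.\<close>
  define close where "close R R' \<longleftrightarrow> real (card (sym_diff R R')) \<le> \<mu> * \<eta> / 4 * n" for R R' :: "'a set"
  have "finite \<R>" using \<R> X(1) finite_subset by blast
  then have finS: "finite S" by (simp add: S_def)
  have n0: "n \<ge> 0" by (simp add: n_def)
  have "\<exists>T\<subseteq>S. (\<forall>x\<in>T. \<forall>y\<in>T. x \<noteq> y \<longrightarrow> \<not> close x y) \<and> (\<forall>x\<in>S. \<exists>y\<in>T. close x y)"
    using finS
  proof (rule maximal_packing)
    show "close R R" for R using \<mu> e n0 by (simp add: close_def)
    show "close R' R" if "close R R'" for R R' using that by (simp add: close_def Un_commute)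
  qed
  then obtain \<P> where P: "\<P> \<subseteq> S" "\<forall>x\<in>\<P>. \<forall>y\<in>\<P>. x \<noteq> y \<longrightarrow> \<not> close x y" "\<forall>x\<in>S. \<exists>y\<in>\<P>. close x y"
    by blast
  have card\<P>: "real (card \<P>) \<le> 6 / \<eta>\<^sup>2 * psi"
  proof (rule shallow_packing_size[OF thr])
    show "\<P> \<subseteq> \<R>" using P(1) by (auto simp: S_def)
    show "real (card R) \<le> \<tau> * real (card X)" if "R \<in> \<P>" for R using that P(1) by (auto simp: S_def n_def)
    show "\<mu> * \<eta> / 4 * real (card X) < real (card (sym_diff R R'))" if "R \<in> \<P>" "R' \<in> \<P>" "R \<noteq> R'" for R R'
      using that P(2) unfolding close_def n_def by (meson not_le)
  qed
  have "\<forall>P\<in>\<P>. \<exists>\<M>. finite \<M> \<and> real (card \<M>) \<le> A * (1/(\<mu>/4)) ^ k \<and>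
        (\<forall>R\<in>\<R>. \<exists>M\<in>\<M>. M \<subseteq> R \<inter> P \<and> real (card (R \<inter> P - M)) \<le> \<mu>/4 * real (card P))"
    using P(1) \<R> \<mu> by (intro ballI inner_approximation) (auto simp: S_def)
  from bchoice[OF this] obtain \<N> where N: "\<forall>P\<in>\<P>. finite (\<N> P) \<and> real (card (\<N> P)) \<le> A * (1/(\<mu>/4)) ^ k \<and>
        (\<forall>R\<in>\<R>. \<exists>M\<in>\<N> P. M \<subseteq> R \<inter> P \<and> real (card (R \<inter> P - M)) \<le> \<mu>/4 * real (card P))" ..
  define \<M> where "\<M> = \<Union>(\<N> ` \<P>)"
  have fin\<P>: "finite \<P>" using P(1) finS finite_subset by blast
  have "finite \<M>" unfolding \<M>_def using fin\<P> N by (intro finite_UN_I) simp_all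
  moreover have "real (card \<M>) \<le> (6 / \<eta>\<^sup>2 * psi) * (A * (4 / \<mu>) ^ k)"
  proof -
    have "card \<M> \<le> (\<Sum>P\<in>\<P>. card (\<N> P))" unfolding \<M>_def using fin\<P> by (rule card_UN_le)
    then have "real (card \<M>) \<le> real (\<Sum>P\<in>\<P>. card (\<N> P))" by (simp only: of_nat_le_iff)
    also have "\<dots> \<le> real (card \<P>) * (A * (1/(\<mu>/4)) ^ k)"
      unfolding of_nat_sum using N by (intro sum_bounded_above) simp
    also have "\<dots> \<le> (6 / \<eta>\<^sup>2 * psi) * (A * (1/(\<mu>/4)) ^ k)"
      using card\<P> A \<mu> by (intro mult_right_mono) auto
    finally show ?thesis by simp
  qed
  moreover have "\<exists>M\<in>\<M>. M \<subseteq> R \<and> (1 - \<mu>) * real (card R) \<le> real (card M)"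
    if R: "R \<in> \<R>" "\<eta> * real (card X) \<le> real (card R)" "real (card R) \<le> \<tau> * real (card X)" for R
  proof -
    have "R \<in> S" using R by (simp add: S_def n_def)
    then obtain P where P': "P \<in> \<P>" "close R P" using P(3) by blast
    then have PR: "P \<in> \<R>" using P(1) by (auto simp: S_def)
    obtain M where M: "M \<in> \<N> P" "M \<subseteq> R \<inter> P" "real (card (R \<inter> P - M)) \<le> \<mu>/4 * real (card P)"
      using bspec[OF N P'(1)] R(1) by blast
    have fin: "finite R" "finite P" using finite_members R PR by auto
    have "\<eta> * n \<le> real (card R)" using R by (simp add: n_def)
    then have "\<mu> / 4 * (\<eta> * n) \<le> \<mu> / 4 * real (card R)" using \<mu> by (intro mult_left_mono) auto
    then have sd: "real (card (sym_diff R P)) \<le> \<mu> / 4 * real (card R)"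
      using P'(2) by (simp add: close_def)
    have "R \<subseteq> (R \<inter> P - M) \<union> M \<union> sym_diff R P" "P \<subseteq> R \<union> sym_diff R P" by auto
    moreover have "finite M" using M(2) fin finite_subset by blast
    ultimately have "card R \<le> card ((R \<inter> P - M) \<union> M \<union> sym_diff R P)" "card P \<le> card (R \<union> sym_diff R P)"
      using fin by (auto intro!: card_mono)
    then have cR: "card R \<le> card (R \<inter> P - M) + card M + card (sym_diff R P)"
      and cP: "card P \<le> card R + card (sym_diff R P)"
      by (meson add_mono card_Un_le le_refl le_trans)+
    have "\<mu> / 4 * real (card R) \<le> 1 * real (card R)" using \<mu> by (intro mult_right_mono) auto
    then have "real (card P) \<le> 2 * real (card R)" using cP sd by linarith
    then have "\<mu>/4 * real (card P) \<le> \<mu>/4 * (2 * real (card R))" using \<mu> by (intro mult_left_mono) auto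
    then have "real (card R) \<le> \<mu>/4 * (2 * real (card R)) + card M + \<mu> / 4 * real (card R)"
      using cR M(3) sd by linarith
    moreover have "0 \<le> \<mu> * real (card R)" using \<mu> by simp
    ultimately have "(1 - \<mu>) * real (card R) \<le> real (card M)" by (simp add: algebra_simps)
    then show ?thesis using M(1,2) P'(1) unfolding \<M>_def by blast
  qed
  ultimately show ?thesis by blast
qed

text \<open>The common bound for two regimes of \<open>\<tau>\<close>. Apart from
  \<open>1 / \<eta>\<^sup>2 * psi\<close>, it contains only constants built from \<open>A\<close>
  and \<open>k\<close>, and a power of \<open>1/\<mu>\<close>.\<close>

lemma Mnet_exists:
  "\<exists>\<M>. heavy_Mnet (1 - \<mu>) \<eta> X \<R> \<M> \<and>
     real (card \<M>) \<le> (7 * A * 4 ^ k * Z ^ k\<^sup>2) * (1 / \<mu>) ^ (k + (J + 2 * k) * k\<^sup>2) * (1 / \<eta>\<^sup>2 * psi)"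
proof -
  note e = \<eta>_bounds
  define z where "z = Z"
  let ?G = "\<exists>\<M>. heavy_Mnet (1 - \<mu>) \<eta> X \<R> \<M> \<and>
     real (card \<M>) \<le> (7 * A * 4 ^ k * z ^ k\<^sup>2) * (1 / \<mu>) ^ (k + (J + 2 * k) * k\<^sup>2) * (1 / \<eta>\<^sup>2 * psi)"
  let ?C = "7 * A * 4 ^ k * z ^ k\<^sup>2" and ?K = "k + (J + 2 * k) * k\<^sup>2"
  define x where "x = 1 / \<mu>"
  have x: "x \<ge> 1" using \<mu> by (simp add: x_def)
  have "\<eta>\<^sup>2 \<le> 1" "\<eta>\<^sup>2 \<le> \<eta>" using e by (auto simp: power2_eq_square mult_le_one mult_left_le)
  then have inv: "1 \<le> 1 / \<eta>\<^sup>2" "1 / \<eta> \<le> 1 / \<eta>\<^sup>2" using e by (auto simp: field_simps)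
  have w: "1 / \<eta>\<^sup>2 \<le> 1 / \<eta>\<^sup>2 * psi" using mult_left_mono[OF psi1, of "1 / \<eta>\<^sup>2"] by simp
  have Zk: "z ^ k\<^sup>2 \<ge> 1" unfolding z_def using Z_ge by (rule one_le_power)
  have trim: ?G
    if "finite \<M>" "real (card \<M>) \<le> ?C * x ^ ?K * (1 / \<eta>\<^sup>2 * psi)"
      "\<And>R. R \<in> \<R> \<Longrightarrow> \<eta> * real (card X) \<le> real (card R) \<Longrightarrow>
        \<exists>M\<in>\<M>. M \<subseteq> R \<and> (1 - \<mu>) * real (card R) \<le> real (card M)" for \<M>
    using that unfolding x_def by (rule heavy_MnetI)
  have ?G
  proof (cases "\<tau> * z \<le> \<mu> ^ (J + 2 * k)")
    \<comment> \<open>Here \<open>1 / \<tau>\<close> is at most a constant times a power of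
      \<open>1/\<mu>\<close>, and therefore so is \<open>(1/\<eta>) ^ k\<close>, the price of
      approximating all of \<open>X\<close> with error \<open>\<mu> * \<eta>\<close>.\<close>
    case False
    have \<mu>\<eta>: "0 < \<mu> * \<eta>" "\<mu> * \<eta> \<le> 1" using \<mu> e by (auto intro: mult_le_one)
    obtain \<M> where M: "finite \<M>" "real (card \<M>) \<le> A * (1/(\<mu> * \<eta>)) ^ k"
      "\<forall>R\<in>\<R>. \<exists>M\<in>\<M>. M \<subseteq> R \<and> real (card R) \<le> real (card M) + \<mu> * \<eta> * real (card X)"
      using global_approximation[OF \<mu>\<eta>] by (elim exE conjE) (rule that)
    show ?thesis
    proof (rule trim[OF M(1)])
      have "\<mu> ^ (J + 2 * k) \<le> \<tau> * z" using False by (rule less_imp_le[OF not_le_imp_less])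
      moreover have "1 / \<tau> \<le> z / p" if "0 < p" "p \<le> \<tau> * z" for p :: real
        using that \<tau> by (simp add: field_simps)
      ultimately have "1 / \<tau> \<le> z / \<mu> ^ (J + 2 * k)" using zero_less_power[OF \<mu>(1)] by blast
      also have "\<dots> = z * x ^ (J + 2 * k)" by (simp only: x_def power_one_over) simp
      finally have "1 / \<tau> \<le> z * x ^ (J + 2 * k)" .
      then have le: "(1 / \<tau>) ^ k\<^sup>2 \<le> (z * x ^ (J + 2 * k)) ^ k\<^sup>2" using \<tau> by (intro power_mono) auto
      have "(1/(\<mu> * \<eta>)) ^ k = x ^ k * (1 / \<tau>) ^ k\<^sup>2"
        by (simp add: \<eta> x_def power_one_over power_mult_distrib power_mult[symmetric] power2_eq_square)
      also have "\<dots> \<le> x ^ k * (z * x ^ (J + 2 * k)) ^ k\<^sup>2" using le x by (intro mult_left_mono) auto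
      also have "\<dots> = z ^ k\<^sup>2 * x ^ ?K"
        by (simp only: power_mult_distrib power_add power_mult) (simp only: mult.left_commute)
      finally have "A * (1/(\<mu> * \<eta>)) ^ k \<le> A * (z ^ k\<^sup>2 * x ^ ?K)" using A by (intro mult_left_mono) auto
      also have "\<dots> = (1 * A * 1 * z ^ k\<^sup>2) * x ^ ?K * 1" by simp
      also have "\<dots> \<le> ?C * x ^ ?K * (1 / \<eta>\<^sup>2 * psi)"
        using A x Zk inv w by (intro mult_mono) auto
      finally show "real (card \<M>) \<le> ?C * x ^ ?K * (1 / \<eta>\<^sup>2 * psi)" using M(2) by linarith
      show "\<exists>M\<in>\<M>. M \<subseteq> R \<and> (1 - \<mu>) * real (card R) \<le> real (card M)"
        if R: "R \<in> \<R>" "\<eta> * real (card X) \<le> real (card R)" for R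
      proof -
        obtain N where N: "N \<in> \<M>" "N \<subseteq> R" "real (card R) \<le> real (card N) + \<mu> * \<eta> * real (card X)"
          using bspec[OF M(3) R(1)] by blast
        have "\<mu> * (\<eta> * real (card X)) \<le> \<mu> * real (card R)" using R \<mu> by (intro mult_left_mono) auto
        then have "(1 - \<mu>) * real (card R) \<le> real (card N)" using N(3) by (simp add: algebra_simps)
        then show ?thesis using N by blast
      qed
    qed
  next
    case True
    have \<mu>\<tau>: "0 < \<mu> * \<tau>" "\<mu> * \<tau> \<le> 1" using \<mu> \<tau> by (auto intro: mult_le_one)
    obtain \<M>1 where M1: "finite \<M>1" "real (card \<M>1) \<le> A * (1/(\<mu> * \<tau>)) ^ k"
      "\<forall>R\<in>\<R>. \<exists>M\<in>\<M>1. M \<subseteq> R \<and> real (card R) \<le> real (card M) + \<mu> * \<tau> * real (card X)"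
      using global_approximation[OF \<mu>\<tau>] by (elim exE conjE) (rule that)
    obtain \<M>2 where M2: "finite \<M>2" "real (card \<M>2) \<le> (6 / \<eta>\<^sup>2 * psi) * (A * (4 / \<mu>) ^ k)"
      "\<forall>R\<in>\<R>. \<eta> * real (card X) \<le> real (card R) \<and> real (card R) \<le> \<tau> * real (card X) \<longrightarrow>
         (\<exists>M\<in>\<M>2. M \<subseteq> R \<and> (1 - \<mu>) * real (card R) \<le> real (card M))"
      using small_members[OF True[unfolded z_def]] by (elim exE conjE) (rule that)
    show ?thesis
    proof (rule trim[of "\<M>1 \<union> \<M>2"])
      show "finite (\<M>1 \<union> \<M>2)" using M1 M2 by simp
      have "(1/(\<mu> * \<tau>)) ^ k = x ^ k * (1 / \<eta>)" by (simp add: \<eta> x_def power_one_over power_mult_distrib)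
      also have "\<dots> \<le> x ^ k * (1 / \<eta>\<^sup>2 * psi)" using inv w x by (intro mult_left_mono) auto
      also have "\<dots> \<le> 4 ^ k * (x ^ k * (1 / \<eta>\<^sup>2 * psi))"
      proof -
        have "0 \<le> x ^ k * (1 / \<eta>\<^sup>2 * psi)" using x inv w by (intro mult_nonneg_nonneg[of "x ^ k"]) auto
        then have "1 * (x ^ k * (1 / \<eta>\<^sup>2 * psi)) \<le> 4 ^ k * (x ^ k * (1 / \<eta>\<^sup>2 * psi))"
          by (intro mult_right_mono) auto
        then show ?thesis by simp
      qed
      finally have c1: "real (card \<M>1) \<le> A * (4 ^ k * (x ^ k * (1 / \<eta>\<^sup>2 * psi)))"
        using M1(2) A by (meson mult_left_mono order.trans zero_le_one)
      have "(4 / \<mu>) ^ k = 4 ^ k * x ^ k" by (simp add: x_def power_divide)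
      then have c2: "real (card \<M>2) \<le> 6 * (A * (4 ^ k * (x ^ k * (1 / \<eta>\<^sup>2 * psi))))"
        using M2(2) by (simp add: algebra_simps)
      have "real (card (\<M>1 \<union> \<M>2)) \<le> real (card \<M>1) + real (card \<M>2)"
        using card_Un_le[of \<M>1 \<M>2] by linarith
      \<comment> \<open>One share for the large members and six for the small ones.\<close>
      also have "\<dots> \<le> 7 * (A * (4 ^ k * (x ^ k * (1 / \<eta>\<^sup>2 * psi))))" using c1 c2 by linarith
      also have "\<dots> = (7 * A * 4 ^ k * 1) * x ^ k * (1 / \<eta>\<^sup>2 * psi)" by simp
      also have "\<dots> \<le> ?C * x ^ ?K * (1 / \<eta>\<^sup>2 * psi)"
      proof -
        have "x ^ k \<le> x ^ ?K" using x by (intro power_increasing) auto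
        then show ?thesis using A x Zk inv w psi1 by (intro mult_mono) auto
      qed
      finally show "real (card (\<M>1 \<union> \<M>2)) \<le> ?C * x ^ ?K * (1 / \<eta>\<^sup>2 * psi)" .
      show "\<exists>M\<in>\<M>1 \<union> \<M>2. M \<subseteq> R \<and> (1 - \<mu>) * real (card R) \<le> real (card M)"
        if R: "R \<in> \<R>" "\<eta> * real (card X) \<le> real (card R)" for R
      proof (cases "real (card R) \<le> \<tau> * real (card X)")
        case True
        then show ?thesis using bspec[OF M2(3) R(1)] R(2) by blast
      next
        case False
        obtain N where N: "N \<in> \<M>1" "N \<subseteq> R" "real (card R) \<le> real (card N) + \<mu> * \<tau> * real (card X)"
          using bspec[OF M1(3) R(1)] by blast
        have "\<mu> * (\<tau> * real (card X)) \<le> \<mu> * real (card R)" using False \<mu> by (intro mult_left_mono) auto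
        then have "(1 - \<mu>) * real (card R) \<le> real (card N)" using N(3) by (simp add: algebra_simps)
        then show ?thesis using N by blast
      qed
    qed
  qed
  then show ?thesis unfolding z_def .
qed

end

section \<open>Absorption of the constants and assembly of the theorem\<close>

text \<open>A point \<open>y\<close> of a shattered set is avoided by some member, so the trace on
  \<open>{y}\<close> contains the empty set and forces \<open>\<psi> 1 1 \<ge> 1\<close>;
  monotonicity does the rest.\<close>

lemma shallow_cell_complexity_ge_1:
  assumes vc: "has_VC_dim X \<R> d0" "d0 \<ge> 1"
    and scc: "has_shallow_cell_complexity X \<R> \<psi>" and mono: "nondecreasing2 \<psi>"
    and ab: "1 \<le> a" "1 \<le> b"
  shows "1 \<le> \<psi> a b"
proof -
  obtain Y where Y: "Y \<subseteq> X" "finite Y" "set_trace \<R> Y = Pow Y" "card Y = d0"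
    using vc(1) unfolding has_VC_dim_def shattered_def by blast
  then obtain y where y: "y \<in> Y" using vc(2) by fastforce
  have "{} \<in> set_trace \<R> Y" unfolding Y(3) by simp
  then obtain R where R: "R \<in> \<R>" "R \<inter> Y = {}" unfolding set_trace_def by blast
  have "R \<inter> {y} = {}" using R(2) y by blast
  then have "R \<inter> {y} \<in> {Z \<in> set_trace \<R> {y}. card Z \<le> 1}"
    using R(1) by (force simp: set_trace_def)
  moreover have "finite {Z \<in> set_trace \<R> {y}. card Z \<le> 1}"
    by (auto intro!: finite_subset[of _ "Pow {y}"] simp: set_trace_def)
  ultimately have "card {Z \<in> set_trace \<R> {y}. card Z \<le> 1} \<ge> 1"
    by (metis One_nat_def Suc_leI card_gt_0_iff empty_iff)
  moreover have "real (card {Z \<in> set_trace \<R> {y}. card Z \<le> 1}) \<le> real (card {y}) * \<psi> (real (card {y})) (real 1)"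
  proof -
    have "{y} \<subseteq> X" "finite {y} \<and> {y} \<noteq> {}" "1 \<le> card {y}" using y Y(1) by auto
    then show ?thesis using scc unfolding has_shallow_cell_complexity_def by blast
  qed
  ultimately have "1 \<le> \<psi> 1 1" by simp
  also have "\<dots> \<le> \<psi> a b" using mono ab unfolding nondecreasing2_def by simp
  finally show ?thesis .
qed

text \<open>The exponent tends to infinity as \<open>\<Lambda>\<close> tends to \<open>0\<close>, so a small \<open>\<Lambda>\<close> absorbs all constants
  depending on \<open>d\<close>, \<open>\<Delta>\<close> and \<open>s\<close>.\<close>

lemma absorbing_exponent:
  fixes C :: real and K :: nat
  shows "\<exists>\<Lambda>. 0 < \<Lambda> \<and> \<Lambda> < 1 \<and> (\<forall>\<mu> (d0::nat). 0 < \<mu> \<and> \<mu> < 1 \<and> d0 \<ge> 1 \<longrightarrow>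
     C * (1 / \<mu>) ^ K \<le> (4 / \<mu>) powr (1 + real d0 / ln (inverse (1 - \<Lambda> / 2))))"
proof -
  define L where "L = max K (max 3 (nat \<lceil>C\<rceil>))"
  have L: "K \<le> L" "3 \<le> L" "C \<le> real L" unfolding L_def by linarith+
  \<comment> \<open>Solves \<open>ln (inverse (1 - \<Lambda> / 2)) = 1 / L\<close>, turning the
    exponent into \<open>1 + d0 * L\<close>. From \<open>L \<ge> 3\<close> follows
    \<open>\<Lambda> \<le> 2 / 3\<close>.\<close>
  define \<Lambda> where "\<Lambda> = 2 * (1 - exp (- 1 / real L))"
  have "- 1 / real L < 0" using L by (simp add: field_simps)
  then have "0 < \<Lambda>" by (simp add: \<Lambda>_def)
  moreover have "\<Lambda> < 1"
  proof -
    have "1 / real L \<le> 1 / 3" using L by (intro divide_left_mono) auto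
    then show ?thesis using exp_ge_add_one_self[of "- 1 / real L"] by (simp add: \<Lambda>_def)
  qed
  moreover have "C * (1 / \<mu>) ^ K \<le> (4 / \<mu>) powr (1 + real d0 / ln (inverse (1 - \<Lambda> / 2)))"
    if \<mu>: "0 < \<mu>" "\<mu> < 1" and d0: "d0 \<ge> 1" for \<mu> and d0 :: nat
  proof -
    have "1 - \<Lambda> / 2 = exp (- (1 / real L))" by (simp add: \<Lambda>_def field_simps)
    then have "ln (inverse (1 - \<Lambda> / 2)) = 1 / real L" by (simp add: exp_minus)
    then have expo: "real d0 / ln (inverse (1 - \<Lambda> / 2)) = real d0 * real L" by simp
    \<comment> \<open>The 4 in the base \<open>4 / \<mu>\<close> absorbs \<open>C\<close>, its
      \<open>1 / \<mu>\<close> the power \<open>K\<close>.\<close>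
    have "L < 2 ^ L" by (rule less_exp)
    also have "\<dots> \<le> (4 :: nat) ^ L" by (rule power_mono) auto
    finally have "real L \<le> 4 ^ L" by (metis less_imp_le of_nat_le_iff of_nat_numeral of_nat_power)
    then have "C \<le> 4 ^ L" using L by linarith
    moreover have "(1 / \<mu>) ^ K \<le> (1 / \<mu>) ^ L" using \<mu> L by (intro power_increasing) auto
    ultimately have "C * (1 / \<mu>) ^ K \<le> 4 ^ L * (1 / \<mu>) ^ L" using \<mu> by (intro mult_mono) auto
    also have "\<dots> = (4 / \<mu>) ^ L" by (simp add: power_divide)
    also have "\<dots> = (4 / \<mu>) powr real L" using \<mu> by (simp add: powr_realpow)
    also have "\<dots> \<le> (4 / \<mu>) powr (1 + real d0 * real L)"
    proof (rule powr_mono)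
      have "1 * real L \<le> real d0 * real L" using d0 by (intro mult_right_mono) auto
      then show "real L \<le> 1 + real d0 * real L" by simp
      show "1 \<le> 4 / \<mu>" using \<mu> by (simp add: field_simps)
    qed
    finally show ?thesis unfolding expo .
  qed
  ultimately show ?thesis by blast
qed

text \<open>The order of the quantifiers expresses the dependence of the constants:
  \<open>c0\<close> precedes \<open>d\<close>, while \<open>\<Lambda>\<close> follows
  \<open>d\<close> but precedes the system, \<open>d0\<close>, \<open>lam\<close> and
  \<open>\<eta>\<close>.\<close>

theorem theorem4p6:
  fixes \<Delta> s :: nat
  assumes "\<Delta> \<ge> 1" and "s \<ge> 1"
  shows "\<exists>c0::real. c0 > 0 \<and> (\<forall>d::nat. d \<ge> 1 \<longrightarrow> (\<exists>\<Lambda>::real. 0 < \<Lambda> \<and> \<Lambda> < 1 \<and>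
    (\<forall>(X :: point set) (\<R> :: point set set) (d0 :: nat) (\<psi> :: real \<Rightarrow> real \<Rightarrow> real).
       X \<subseteq> Rspace d \<and> finite X \<and>
       generated_by X \<R> (semialg_class d \<Delta> s) \<and>
       has_VC_dim X \<R> d0 \<and> d0 \<ge> 1 \<and>
       has_shallow_cell_complexity X \<R> \<psi> \<and> nondecreasing2 \<psi> \<longrightarrow>
       (\<forall>lam \<eta> :: real. 0 < lam \<and> lam < 1 \<and> 0 < \<eta> \<and> \<eta> < 1 \<longrightarrow>
          (\<exists>\<M> :: point set set. heavy_Mnet lam \<eta> X \<R> \<M> \<and>
             real (card \<M>) \<le>
               (c0 * exp 1) ^ d0
               * (4 / (1 - lam)) powr (1 + real d0 / ln (inverse (1 - \<Lambda> / 2)))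
               * (24 * real d0 / \<eta>\<^sup>2)
               * \<psi> (4 * real d0 / \<eta>\<^sup>2) (15 * real d0 / \<eta>))))))"
proof (rule exI[of _ 1], intro conjI allI impI)
  fix d :: nat
  obtain A k where Ak: "(A::real) \<ge> 1" "(k::nat) \<ge> 1"
    and approx: "\<forall>P \<epsilon>. finite P \<and> P \<subseteq> Rspace d \<and> 0 < \<epsilon> \<and> \<epsilon> \<le> 1 \<longrightarrow>
     (\<exists>\<M>. finite \<M> \<and> real (card \<M>) \<le> A * (1/\<epsilon>) ^ k \<and>
        (\<forall>S\<in>semialg_class d \<Delta> s. \<exists>M\<in>\<M>. M \<subseteq> S \<inter> P \<and> real (card (S \<inter> P - M)) \<le> \<epsilon> * real (card P)))"
    using semialg_inner_approximation[of d \<Delta> s] by (elim exE conjE) (rule that)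
  \<comment> \<open>The constants of \<open>Mnet_exists\<close> are determined by \<open>A\<close>
    and \<open>k\<close>, so \<open>\<Lambda>\<close> can be fixed before any system is
    given.\<close>
  obtain C K where Mnet: "\<And>X \<R> \<psi> D \<mu> \<eta> \<tau>. shallow_system A k X (\<R> :: point set set) \<psi> D \<mu> \<eta> \<tau> \<Longrightarrow>
     \<exists>\<M>. heavy_Mnet (1 - \<mu>) \<eta> X \<R> \<M> \<and>
       real (card \<M>) \<le> C * (1 / \<mu>) ^ K * (1 / \<eta>\<^sup>2 * \<psi> (4 * D / \<eta>\<^sup>2) (15 * D / \<eta>))"
    using shallow_system.Mnet_exists by (rule that)
  obtain \<Lambda> where \<Lambda>: "0 < \<Lambda>" "\<Lambda> < 1" "\<And>\<mu> d0. 0 < \<mu> \<Longrightarrow> \<mu> < 1 \<Longrightarrow> d0 \<ge> 1 \<Longrightarrow>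
     C * (1 / \<mu>) ^ K \<le> (4 / \<mu>) powr (1 + real d0 / ln (inverse (1 - \<Lambda> / 2)))"
    using absorbing_exponent[of C K] by blast
  have "\<exists>\<M>. heavy_Mnet lam \<eta> X \<R> \<M> \<and>
             real (card \<M>) \<le>
               (1 * exp 1) ^ d0
               * (4 / (1 - lam)) powr (1 + real d0 / ln (inverse (1 - \<Lambda> / 2)))
               * (24 * real d0 / \<eta>\<^sup>2)
               * \<psi> (4 * real d0 / \<eta>\<^sup>2) (15 * real d0 / \<eta>)"
    if X: "X \<subseteq> Rspace d" "finite X" and gen: "generated_by X \<R> (semialg_class d \<Delta> s)"
      and vc: "has_VC_dim X \<R> d0" "d0 \<ge> 1"
      and scc: "has_shallow_cell_complexity X \<R> \<psi>" "nondecreasing2 \<psi>"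
      and lam: "0 < lam" "lam < 1" and \<eta>: "0 < \<eta>" "\<eta> < 1" for X \<R> d0 \<psi> lam \<eta>
  proof -
    let ?psi = "\<psi> (4 * real d0 / \<eta>\<^sup>2) (15 * real d0 / \<eta>)"
    have "X \<noteq> {}" using vc unfolding has_VC_dim_def by fastforce
    have \<R>X: "\<R> \<subseteq> Pow X" using gen unfolding generated_by_def by blast
    have inner: "\<exists>\<M>. finite \<M> \<and> real (card \<M>) \<le> A * (1/\<epsilon>) ^ k \<and>
        (\<forall>R\<in>\<R>. \<exists>M\<in>\<M>. M \<subseteq> R \<inter> P \<and> real (card (R \<inter> P - M)) \<le> \<epsilon> * real (card P))"
      if P: "P \<subseteq> X" and \<epsilon>: "0 < \<epsilon>" "\<epsilon> \<le> 1" for P \<epsilon>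
    proof -
      have "finite P \<and> P \<subseteq> Rspace d \<and> 0 < \<epsilon> \<and> \<epsilon> \<le> 1" using P X \<epsilon> finite_subset by auto
      from approx[rule_format, OF this] obtain \<M> where M: "finite \<M>" "real (card \<M>) \<le> A * (1/\<epsilon>) ^ k"
        "\<forall>S\<in>semialg_class d \<Delta> s. \<exists>M\<in>\<M>. M \<subseteq> S \<inter> P \<and> real (card (S \<inter> P - M)) \<le> \<epsilon> * real (card P)"
        by (elim exE conjE) (rule that)
      have "\<exists>M\<in>\<M>. M \<subseteq> R \<inter> P \<and> real (card (R \<inter> P - M)) \<le> \<epsilon> * real (card P)" if R: "R \<in> \<R>" for R
      proof -
        obtain S where S: "S \<in> semialg_class d \<Delta> s" "R = S \<inter> X"
          using gen R unfolding generated_by_def by blast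
        have "R \<inter> P = S \<inter> P" using S(2) P by blast
        then show ?thesis using bspec[OF M(3) S(1)] by simp
      qed
      then show ?thesis using M(1,2) by blast
    qed
    have \<eta>2: "\<eta>\<^sup>2 \<le> 1" using \<eta> by (simp add: power_le_one)
    have "1 \<le> 4 * real d0 / \<eta>\<^sup>2" "1 \<le> 15 * real d0 / \<eta>"
      using \<eta> \<eta>2 vc(2) by (auto simp: le_divide_eq)
    from shallow_cell_complexity_ge_1[OF vc scc this] have psi1: "1 \<le> ?psi" .
    \<comment> \<open>As \<open>k \<ge> 1\<close>, the root lies in \<open>(0,1)\<close> and has
      \<open>\<eta>\<close> as its \<open>k\<close>-th power.\<close>
    have "shallow_system A k X \<R> \<psi> (real d0) (1 - lam) \<eta> (root k \<eta>)"
    proof (unfold_locales)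
      show "0 < root k \<eta>" "root k \<eta> < 1" "\<eta> = root k \<eta> ^ k" using Ak \<eta> by auto
    qed (use X \<open>X \<noteq> {}\<close> \<R>X Ak inner scc vc lam psi1 in auto)
    from Mnet[OF this] obtain \<M> where M: "heavy_Mnet lam \<eta> X \<R> \<M>"
      "real (card \<M>) \<le> C * (1 / (1 - lam)) ^ K * (1 / \<eta>\<^sup>2 * ?psi)" by auto
    let ?E = "(4 / (1 - lam)) powr (1 + real d0 / ln (inverse (1 - \<Lambda> / 2)))"
    have "C * (1 / (1 - lam)) ^ K * (1 / \<eta>\<^sup>2 * ?psi) \<le> ?E * (1 / \<eta>\<^sup>2 * ?psi)"
      using \<Lambda>(3)[of "1 - lam" d0] lam vc(2) psi1 by (intro mult_right_mono) auto
    \<comment> \<open>The factors \<open>exp 1 ^ d0\<close> and \<open>24 * d0\<close> are at least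
      1, and \<open>?psi\<close> is positive.\<close>
    also have "\<dots> \<le> ((1 * exp 1) ^ d0 * ?E) * ((24 * real d0 / \<eta>\<^sup>2) * ?psi)"
    proof (intro mult_mono)
      have "1 \<le> (1 * exp 1 :: real) ^ d0" by (intro one_le_power) simp
      then show "?E \<le> (1 * exp 1) ^ d0 * ?E" using mult_right_mono[of 1 "(1 * exp 1 :: real) ^ d0" ?E] by simp
      show "1 / \<eta>\<^sup>2 \<le> 24 * real d0 / \<eta>\<^sup>2" using vc(2) by (intro divide_right_mono) auto
    qed (use psi1 in auto)
    finally show ?thesis using M by (intro exI[of _ \<M>]) (simp add: mult.assoc)
  qed
  then show "\<exists>\<Lambda>::real. 0 < \<Lambda> \<and> \<Lambda> < 1 \<and>
    (\<forall>(X :: point set) (\<R> :: point set set) (d0 :: nat) (\<psi> :: real \<Rightarrow> real \<Rightarrow> real).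
       X \<subseteq> Rspace d \<and> finite X \<and>
       generated_by X \<R> (semialg_class d \<Delta> s) \<and>
       has_VC_dim X \<R> d0 \<and> d0 \<ge> 1 \<and>
       has_shallow_cell_complexity X \<R> \<psi> \<and> nondecreasing2 \<psi> \<longrightarrow>
       (\<forall>lam \<eta> :: real. 0 < lam \<and> lam < 1 \<and> 0 < \<eta> \<and> \<eta> < 1 \<longrightarrow>
          (\<exists>\<M> :: point set set. heavy_Mnet lam \<eta> X \<R> \<M> \<and>
             real (card \<M>) \<le>
               (1 * exp 1) ^ d0
               * (4 / (1 - lam)) powr (1 + real d0 / ln (inverse (1 - \<Lambda> / 2)))
               * (24 * real d0 / \<eta>\<^sup>2)
               * \<psi> (4 * real d0 / \<eta>\<^sup>2) (15 * real d0 / \<eta>))))"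
    using \<Lambda>(1,2) by blast
qed simp

end
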